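(* Let $\delta_1\in(0,1)$, $\delta_0>0$, and let $(\alpha,S)$ be a phase-type job size distribution with mean $1$. For integers $m\ge0$ put $$\lambda_m=\frac{\delta_0-\delta_0(1-\delta_1)^m}{\delta_0-\delta_0(1-\delta_1)^m+\delta_1(1-\delta_1)^m} .$$ Then for every integer $m>0$, the maximum queue length of the queue at the cavity of the pull policy with arrival rate $\lambda$ equals $m$ for $\lambda\in(\lambda_{m-1},\lambda_m]$.
   Context: Job sizes have a phase-type (PH) distribution $(\alpha,S)$: $\alpha$ is a probability row vector of length $n_s$, $S$ an invertible $n_s\times n_s$ subgenerator matrix, $s^*=-S\mathbf 1$ ($\mathbf 1$ the all-ones column), and the mean is $\alpha(-S)^{-1}\mathbf 1=1$. In the pull policy a server reports its queue length with probability $\delta_1$ at each job completion and at rate $\delta_0$ when idle. Pull policy chain: for an integer $m\ge 0$ and a real $\nu\ge 0$, consider the continuous-time Markov chain on the states $(0,e)$ and $(q,e,j)$ with $e\in\{m,m+1\}$, $1\le q\le e$, $1\le j\le n_s$ ($q$ = actual queue length, $e$ = estimated queue length, $j$ = service phase), with the following transitions. (i) Phase changes: $(q,e,j)\to(q,e,j')$ at rate $S_{jj'}$, $j\ne j'$. (ii) Completions without update: $(q,e,j)\to(q-1,e,j')$ at rate $(1-\delta_1)s^*_j\alpha_{j'}$ if $q\ge2$; $(1,e,j)\to(0,e)$ at rate $(1-\delta_1)s_j^*$. (iii) Completions with update: $(q,e,j)\to(m,m,j')$ at rate $\delta_1s^*_j\alpha_{j'}$ if $m\ge1$ (if $m=0$: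 $(1,1,j)\to(0,0)$ at rate $\delta_1s^*_j$). (iv) Idle updates: $(0,e)\to(m,m,j')$ at rate $\delta_0\alpha_{j'}$ if $m\ge1$ (if $m=0$: $(0,e)\to(0,0)$ at rate $\delta_0$). (v) Job assignments: $(q,m,j)\to(q+1,m+1,j)$ at rate $\nu$ for $q\ge1$; $(0,m)\to(1,m+1,j')$ at rate $\nu\alpha_{j'}$. Let $\pi_q(m,\nu)$ be the stationary probability that the actual queue length is $q$. Queue at the cavity with arrival rate $\lambda\in[0,1)$: the stationary chain for the unique pair $(m,\nu)$, $m\in\{0,1,2,\dots\}$, $\nu\in[0,\infty)$, with $\pi_0(m,\nu)=1-\lambda$. Its maximum queue length is the largest $q$ with $\pi_q(m,\nu)>0$. *)

theory Defs
  imports "HOL-Analysis.Analysis" "HOL-Probability.Probability_Mass_Function"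
begin

text \<open>
  Phases are the elements of a finite type \<open>'n\<close>, so \<open>n_s = CARD('n)\<close>; \<open>1 :: real^'n\<close> is the
  all-ones vector. Nonpositivity of the diagonal follows from the two clauses below.
\<close>

definition subgenerator :: "real^'n^'n \<Rightarrow> bool" where
  "subgenerator S \<longleftrightarrow>
     (\<forall>i j. i \<noteq> j \<longrightarrow> 0 \<le> S $ i $ j) \<and> (\<forall>i. (\<Sum>j\<in>UNIV. S $ i $ j) \<le> 0)"

definition phase_type :: "real^'n \<Rightarrow> real^'n^'n \<Rightarrow> bool" where
  "phase_type \<alpha> S \<longleftrightarrow>
     (\<forall>j. 0 \<le> \<alpha> $ j) \<and> (\<Sum>j\<in>UNIV. \<alpha> $ j) = 1 \<and> subgenerator S \<and> invertible S"

definition exit_rate :: "real^'n^'n \<Rightarrow> real^'n" where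
  "exit_rate S = - (S *v 1)"

definition phase_type_mean :: "real^'n \<Rightarrow> real^'n^'n \<Rightarrow> real" where
  "phase_type_mean \<alpha> S = \<alpha> \<bullet> (matrix_inv (- S) *v 1)"

text \<open>
  A distribution on the finite state set \<open>X\<close> is stationary for the continuous-time chain with
  transition rates \<open>r\<close> if it satisfies global balance. Self-transitions \<open>r x x\<close> contribute equally
  to both sides, so they are irrelevant and need not be excluded from \<open>r\<close>.
\<close>

definition stationary :: "'s set \<Rightarrow> ('s \<Rightarrow> 's \<Rightarrow> real) \<Rightarrow> 's pmf \<Rightarrow> bool" where
  "stationary X r p \<longleftrightarrow> set_pmf p \<subseteq> X \<and>
     (\<forall>y\<in>X. (\<Sum>x\<in>X. pmf p x * r x y) = pmf p y * (\<Sum>z\<in>X. r y z))"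

text \<open>\<open>Idle e\<close> is the state \<open>(0,e)\<close>, and \<open>Busy q e j\<close> is the state \<open>(q,e,j)\<close>.\<close>

datatype 'n state = Idle nat | Busy nat nat 'n

fun queue_length :: "'n state \<Rightarrow> nat" where
  "queue_length (Idle e) = 0"
| "queue_length (Busy q e j) = q"

definition pull_states :: "nat \<Rightarrow> 'n state set" where
  "pull_states m =
     {Idle e | e. e \<in> {m, m + 1}} \<union> {Busy q e j | q e j. e \<in> {m, m + 1} \<and> 1 \<le> q \<and> q \<le> e}"

text \<open>
  Several kinds of transition can join the same pair of states (a phase change and a completion
  with update, for instance), so their rates are added up.
\<close>

fun pull_rate ::
  "real^'n \<Rightarrow> real^'n^'n \<Rightarrow> real \<Rightarrow> real \<Rightarrow> nat \<Rightarrow> real \<Rightarrow> 'n state \<Rightarrow> 'n state \<Rightarrow> real" where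
  "pull_rate \<alpha> S \<delta>\<^sub>1 \<delta>\<^sub>0 m \<nu> (Busy q e j) (Busy q' e' j') =
     (if q' = q \<and> e' = e \<and> j' \<noteq> j then S $ j $ j' else 0)
   + (if q \<ge> 2 \<and> q' = q - 1 \<and> e' = e then (1 - \<delta>\<^sub>1) * exit_rate S $ j * \<alpha> $ j' else 0)
   + (if m \<ge> 1 \<and> q' = m \<and> e' = m then \<delta>\<^sub>1 * exit_rate S $ j * \<alpha> $ j' else 0)
   + (if e = m \<and> q' = q + 1 \<and> e' = m + 1 \<and> j' = j then \<nu> else 0)"
| "pull_rate \<alpha> S \<delta>\<^sub>1 \<delta>\<^sub>0 m \<nu> (Busy q e j) (Idle e') =
     (if q = 1 \<and> e' = e then (1 - \<delta>\<^sub>1) * exit_rate S $ j else 0)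
   + (if m = 0 \<and> q = 1 \<and> e = 1 \<and> e' = 0 then \<delta>\<^sub>1 * exit_rate S $ j else 0)"
| "pull_rate \<alpha> S \<delta>\<^sub>1 \<delta>\<^sub>0 m \<nu> (Idle e) (Busy q' e' j') =
     (if m \<ge> 1 \<and> q' = m \<and> e' = m then \<delta>\<^sub>0 * \<alpha> $ j' else 0)
   + (if e = m \<and> q' = 1 \<and> e' = m + 1 then \<nu> * \<alpha> $ j' else 0)"
| "pull_rate \<alpha> S \<delta>\<^sub>1 \<delta>\<^sub>0 m \<nu> (Idle e) (Idle e') =
     (if m = 0 \<and> e' = 0 then \<delta>\<^sub>0 else 0)"

definition pull_stationary ::
  "real^'n \<Rightarrow> real^'n^'n \<Rightarrow> real \<Rightarrow> real \<Rightarrow> nat \<Rightarrow> real \<Rightarrow> 'n state pmf" where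
  "pull_stationary \<alpha> S \<delta>\<^sub>1 \<delta>\<^sub>0 m \<nu> =
     (THE p. stationary (pull_states m) (pull_rate \<alpha> S \<delta>\<^sub>1 \<delta>\<^sub>0 m \<nu>) p)"

definition queue_prob ::
  "real^'n \<Rightarrow> real^'n^'n \<Rightarrow> real \<Rightarrow> real \<Rightarrow> nat \<Rightarrow> real \<Rightarrow> nat \<Rightarrow> real" where
  "queue_prob \<alpha> S \<delta>\<^sub>1 \<delta>\<^sub>0 m \<nu> q =
     measure_pmf.prob (pull_stationary \<alpha> S \<delta>\<^sub>1 \<delta>\<^sub>0 m \<nu>) {x. queue_length x = q}"

definition cavity_params ::
  "real^'n \<Rightarrow> real^'n^'n \<Rightarrow> real \<Rightarrow> real \<Rightarrow> real \<Rightarrow> nat \<times> real" where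
  "cavity_params \<alpha> S \<delta>\<^sub>1 \<delta>\<^sub>0 arr =
     (THE (m, \<nu>). 0 \<le> \<nu> \<and> queue_prob \<alpha> S \<delta>\<^sub>1 \<delta>\<^sub>0 m \<nu> 0 = 1 - arr)"

definition cavity_max_queue_length ::
  "real^'n \<Rightarrow> real^'n^'n \<Rightarrow> real \<Rightarrow> real \<Rightarrow> real \<Rightarrow> nat" where
  "cavity_max_queue_length \<alpha> S \<delta>\<^sub>1 \<delta>\<^sub>0 arr =
     (case cavity_params \<alpha> S \<delta>\<^sub>1 \<delta>\<^sub>0 arr of
        (m, \<nu>) \<Rightarrow> GREATEST q. queue_prob \<alpha> S \<delta>\<^sub>1 \<delta>\<^sub>0 m \<nu> q > 0)"

definition critical_rate :: "real \<Rightarrow> real \<Rightarrow> nat \<Rightarrow> real" where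
  "critical_rate \<delta>\<^sub>1 \<delta>\<^sub>0 m =
     (\<delta>\<^sub>0 - \<delta>\<^sub>0 * (1 - \<delta>\<^sub>1) ^ m) /
     (\<delta>\<^sub>0 - \<delta>\<^sub>0 * (1 - \<delta>\<^sub>1) ^ m + \<delta>\<^sub>1 * (1 - \<delta>\<^sub>1) ^ m)"

end

theory Submission
  imports Defs
begin

text \<open>
  Write \<open>p = 1 - \<delta>\<^sub>1\<close>, and let \<open>\<phi>\<close> be the Laplace transform of the job size. Between two updates the
  chain first moves down the levels \<open>(q,m)\<close> and, after an assignment, the levels \<open>(q,m+1)\<close>; every
  completion is without update with probability \<open>p\<close>, and a job started at estimate \<open>m\<close> ends before
  an assignment with probability \<open>\<phi>(\<nu>)\<close>. Hence the balance equations are triangular once the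
  total update rate is normalised, and their solution depends on \<open>\<nu>\<close> through
  \<open>M = p\<^sup>m (p + \<delta>\<^sub>1 w)\<close> with \<open>w = \<phi>(\<nu>)\<^sup>m \<delta>\<^sub>0 / (\<nu> + \<delta>\<^sub>0)\<close>: the idle probability is
  \<open>\<delta>\<^sub>1 M / (\<delta>\<^sub>0 (1 - M) + \<delta>\<^sub>1 M)\<close>, which is \<open>1 - \<lambda>\<^sub>m\<close> when \<open>M = p\<^sup>m\<close>.
  Since \<open>w\<close> decreases continuously and strictly from \<open>1\<close> to \<open>0\<close>, \<open>M\<close> takes each value in
  \<open>(p\<^sup>m\<^sup>+\<^sup>1, p\<^sup>m]\<close> exactly once, and these intervals partition \<open>(0,1]\<close>.
  Finally, queue length \<open>m+1\<close> is reached if and only if \<open>\<nu> > 0\<close>.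
\<close>

subsection \<open>Subgenerators\<close>

text \<open>Absorption is reachable from every phase, expressed through sets instead of paths: no
  nonempty set of phases is closed without exit. This form applies directly to the set where a
  vector attains its minimum.\<close>

definition all_phases_exit :: "real^'n^'n \<Rightarrow> bool" where
  "all_phases_exit S \<longleftrightarrow>
     (\<forall>I. I \<noteq> {} \<longrightarrow> (\<exists>i\<in>I. (\<Sum>j\<in>UNIV. S $ i $ j) < 0 \<or> (\<exists>j. j \<notin> I \<and> 0 < S $ i $ j)))"

lemma all_phases_exitD:
  assumes "all_phases_exit S" "P k"
  shows "\<exists>i. P i \<and> ((\<Sum>j\<in>UNIV. S $ i $ j) < 0 \<or> (\<exists>j. \<not> P j \<and> 0 < S $ i $ j))"
proof -
  have "Collect P \<noteq> {}" using assms(2) by blast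
  from assms(1)[unfolded all_phases_exit_def, rule_format, OF this] show ?thesis
    by (simp add: Bex_def)
qed

lemma matrix_inv:
  fixes A :: "'a::semiring_1^'n^'m"
  assumes "invertible A"
  shows matrix_inv_right: "A ** matrix_inv A = mat 1" and matrix_inv_left: "matrix_inv A ** A = mat 1"
  using someI_ex[OF assms[unfolded invertible_def]] unfolding matrix_inv_def by auto

lemma invertible_imp_all_phases_exit:
  fixes S :: "real^'n^'n"
  assumes sub: "subgenerator S" and inv: "invertible S"
  shows "all_phases_exit S"
  unfolding all_phases_exit_def
  \<comment> \<open>A closed set \<open>I\<close> without exit makes the block of \<open>S\<close> on \<open>I\<close> onto and yet of row sums \<open>0\<close>;
      \<open>T\<close> below is that block, extended by the identity.\<close>
proof (intro allI impI, rule ccontr)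
  fix I :: "'n set"
  assume ne: "I \<noteq> {}"
    and H: "\<not> (\<exists>i\<in>I. (\<Sum>j\<in>UNIV. S $ i $ j) < 0 \<or> (\<exists>j. j \<notin> I \<and> 0 < S $ i $ j))"
  have row: "(\<Sum>j\<in>UNIV. S $ i $ j) = 0" if "i \<in> I" for i
    using H sub that unfolding subgenerator_def by (meson antisym not_le)
  have zero: "S $ i $ j = 0" if "i \<in> I" "j \<notin> I" for i j
    using H sub that unfolding subgenerator_def by (metis antisym not_le)
  define T :: "real^'n^'n" where "T = (\<chi> i j. if i \<in> I then S $ i $ j else of_bool (i = j))"
  have "surj ((*v) T)"
  proof (rule surjI)
    \<comment> \<open>Rows of \<open>S\<close> in \<open>I\<close> vanish off \<open>I\<close>, so
      the solution of \<open>S *v x = b\<close> may be replaced off \<open>I\<close> by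
      \<open>b\<close>, which is what the unit rows of \<open>T\<close> require there.\<close>
    fix b :: "real^'n"
    define x where "x = matrix_inv S *v b"
    define y where "y = (\<chi> j. if j \<in> I then x $ j else b $ j)"
    have Sx: "S *v x = b"
      unfolding x_def matrix_vector_mul_assoc matrix_inv_right[OF inv] by simp
    have "(T *v y) $ i = b $ i" for i
    proof (cases "i \<in> I")
      case True
      have "(T *v y) $ i = (S *v x) $ i"
        unfolding matrix_vector_mult_def T_def y_def
        using True zero by (auto intro!: sum.cong)
      then show ?thesis using Sx by simp
    next
      case False
      then show ?thesis
        by (simp add: matrix_vector_mult_def T_def y_def of_bool_def if_distrib[of "\<lambda>a. a * _"] cong: if_cong)
    qed
    then show "T *v (\<chi> j. if j \<in> I then (matrix_inv S *v b) $ j else b $ j) = b"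
      unfolding y_def x_def by (simp add: vec_eq_iff)
  qed
  then have "invertible T"
    by (simp only: invertible_right_inverse matrix_right_invertible_surjective)
  then have "inj ((*v) T)"
    by (simp only: invertible_left_inverse matrix_left_invertible_injective)
  \<comment> \<open>The indicator of \<open>I\<close> is in the kernel: rows in \<open>I\<close>
    have sum 0 over \<open>I\<close>, and the unit rows pick coordinates where it vanishes.\<close>
  moreover have "T *v (\<chi> j. of_bool (j \<in> I)) = T *v 0"
  proof -
    have "(T *v (\<chi> j. of_bool (j \<in> I))) $ i = 0" for i
    proof (cases "i \<in> I")
      case True
      have "(T *v (\<chi> j. of_bool (j \<in> I))) $ i = (\<Sum>j\<in>UNIV. S $ i $ j)"
        using True zero by (simp add: matrix_vector_mult_def T_def of_bool_def) (rule sum.cong, auto)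
      then show ?thesis using row True by simp
    next
      case False
      then show ?thesis
        unfolding matrix_vector_mult_def T_def by (auto intro!: sum.neutral)
    qed
    then show ?thesis by (simp add: vec_eq_iff)
  qed
  ultimately have "(\<chi> j. of_bool (j \<in> I)) = (0::real^'n)" by (rule injD)
  then show False using ne by (auto simp: vec_eq_iff)
qed

lemma all_phases_exit_shift:
  assumes "all_phases_exit S" "0 \<le> \<nu>"
  shows "all_phases_exit (S - mat \<nu>)"
  unfolding all_phases_exit_def
proof (intro allI impI)
  fix I :: "'a set"
  assume "I \<noteq> {}"
  then obtain i where i: "i \<in> I" "(\<Sum>j\<in>UNIV. S $ i $ j) < 0 \<or> (\<exists>j. j \<notin> I \<and> 0 < S $ i $ j)"
    using assms unfolding all_phases_exit_def by blast
  have "(\<Sum>j\<in>UNIV. (S - mat \<nu>) $ i $ j) = (\<Sum>j\<in>UNIV. S $ i $ j) - \<nu>"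
    by (simp add: sum_subtractf mat_def)
  moreover have "j \<notin> I \<Longrightarrow> (S - mat \<nu>) $ i $ j = S $ i $ j" for j
    using i(1) by (auto simp: mat_def)
  ultimately show "\<exists>i\<in>I. (\<Sum>j\<in>UNIV. (S - mat \<nu>) $ i $ j) < 0 \<or> (\<exists>j. j \<notin> I \<and> 0 < (S - mat \<nu>) $ i $ j)"
    using i assms(2) by (intro bexI[of _ i]) force+
qed

lemma subgenerator_shift:
  assumes "subgenerator S" "0 \<le> \<nu>"
  shows "subgenerator (S - mat \<nu>)"
proof -
  have "(\<Sum>j\<in>UNIV. (S - mat \<nu>) $ i $ j) = (\<Sum>j\<in>UNIV. S $ i $ j) - \<nu>" for i
    by (simp add: sum_subtractf mat_def)
  moreover have "i \<noteq> j \<Longrightarrow> (S - mat \<nu>) $ i $ j = S $ i $ j" for i j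
    by (simp add: mat_def)
  moreover have "(\<Sum>j\<in>UNIV. S $ i $ j) \<le> 0" for i
    using assms unfolding subgenerator_def by blast
  ultimately show ?thesis
    using assms unfolding subgenerator_def by (auto intro: order_trans)
qed

text \<open>A minimum principle: the set where a negative minimum is attained would be closed without exit.\<close>

lemma subgenerator_monotone:
  fixes S :: "real^'n^'n" and v :: "real^'n"
  assumes sub: "subgenerator S" and exit: "all_phases_exit S"
    and le: "\<And>i. (S *v v) $ i \<le> 0"
  shows "0 \<le> v $ i"
proof (rule ccontr)
  assume neg: "\<not> 0 \<le> v $ i"
  define \<mu> where "\<mu> = Min (range (($) v))"
  have min: "\<mu> \<le> v $ j" for j unfolding \<mu>_def by simp
  have "\<mu> < 0" using min[of i] neg by simp
  have "\<mu> \<in> range (($) v)" unfolding \<mu>_def by (intro Min_in) auto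
  then obtain k0 where "v $ k0 = \<mu>" by auto
  then obtain k where k: "v $ k = \<mu>"
    "(\<Sum>j\<in>UNIV. S $ k $ j) < 0 \<or> (\<exists>j. v $ j \<noteq> \<mu> \<and> 0 < S $ k $ j)"
    using all_phases_exitD[OF exit, of "\<lambda>k. v $ k = \<mu>" k0] by blast
  have off: "0 \<le> S $ k $ j * (v $ j - \<mu>)" for j
    using sub min[of j] k(1) unfolding subgenerator_def by (cases "j = k") auto
  \<comment> \<open>Centred at the minimum, the diagonal term drops out because
    \<open>v $ k = \<mu>\<close>, and all remaining terms of the sum are nonnegative.\<close>
  have split: "(S *v v) $ k = (\<Sum>j\<in>UNIV. S $ k $ j * (v $ j - \<mu>)) + \<mu> * (\<Sum>j\<in>UNIV. S $ k $ j)"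
    by (simp add: matrix_vector_mult_def right_diff_distrib sum_subtractf sum_distrib_left mult.commute)
  have row: "0 \<le> \<mu> * (\<Sum>j\<in>UNIV. S $ k $ j)"
    using sub \<open>\<mu> < 0\<close> unfolding subgenerator_def by (simp add: mult_nonpos_nonpos)
  have nn: "0 \<le> (\<Sum>j\<in>UNIV. S $ k $ j * (v $ j - \<mu>))"
    by (intro sum_nonneg off)
  from k(2) have "0 < (S *v v) $ k"
  proof
    assume "(\<Sum>j\<in>UNIV. S $ k $ j) < 0"
    then show ?thesis using split nn \<open>\<mu> < 0\<close> by (simp add: mult_neg_neg add_nonneg_pos)
  next
    assume "\<exists>j. v $ j \<noteq> \<mu> \<and> 0 < S $ k $ j"
    then obtain j where "v $ j \<noteq> \<mu>" "0 < S $ k $ j" by blast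
    then have "0 < S $ k $ j * (v $ j - \<mu>)" using min[of j] by simp
    then have "0 < (\<Sum>j\<in>UNIV. S $ k $ j * (v $ j - \<mu>))"
      by (intro sum_pos2[of _ j]) (auto simp: off)
    then show ?thesis using split row by simp
  qed
  then show False using le[of k] by simp
qed

lemma exit_rate_nth: "exit_rate S $ i = - (\<Sum>j\<in>UNIV. S $ i $ j)"
  by (simp add: exit_rate_def matrix_vector_mult_def)

lemma exit_rate_nonneg: "subgenerator S \<Longrightarrow> 0 \<le> exit_rate S $ i"
  by (simp add: exit_rate_nth subgenerator_def)

lemma inner_vec_nonneg:
  fixes x y :: "real^'n"
  shows "(\<And>i. 0 \<le> x $ i) \<Longrightarrow> (\<And>i. 0 \<le> y $ i) \<Longrightarrow> 0 \<le> x \<bullet> y"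
  by (simp add: inner_vec_def sum_nonneg)

lemma matrix_vector_mult_mat_real: "(mat c :: real^'n^'n) *v v = c *\<^sub>R v"
proof -
  have "((mat c :: real^'n^'n) *v v) $ i = c * v $ i" for i
    by (simp add: matrix_vector_mult_def mat_def if_distrib[of "\<lambda>a. a * _"] cong: if_cong)
  then show ?thesis by (simp add: vec_eq_iff)
qed

lemma vector_matrix_mult_mat_real: "v v* (mat c :: real^'n^'n) = c *\<^sub>R v"
proof -
  have "(v v* (mat c :: real^'n^'n)) $ i = c * v $ i" for i
    by (simp add: vector_matrix_mult_def mat_def if_distrib cong: if_cong)
  then show ?thesis by (simp add: vec_eq_iff)
qed

section \<open>Finite sums over states and row vectors\<close>

lemma sum_pull_states:
  fixes f :: "'n::finite state \<Rightarrow> real"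
  shows "(\<Sum>x\<in>pull_states m. f x) = f (Idle m) + f (Idle (m + 1))
    + (\<Sum>q=1..m. \<Sum>j\<in>UNIV. f (Busy q m j)) + (\<Sum>q=1..m+1. \<Sum>j\<in>UNIV. f (Busy q (m + 1) j))"
proof -
  let ?B = "\<lambda>e. (\<lambda>(q, j). Busy q e j) ` ({1..e} \<times> UNIV) :: 'n state set"
  have states: "pull_states m = {Idle m, Idle (m + 1)} \<union> (?B m \<union> ?B (m + 1))"
    by (auto simp: pull_states_def image_iff)
  have block: "(\<Sum>x\<in>?B e. f x) = (\<Sum>q=1..e. \<Sum>j\<in>UNIV. f (Busy q e j))" for e
    by (subst sum.reindex) (auto simp: inj_on_def sum.cartesian_product intro!: sum.cong)
  have "(\<Sum>x\<in>pull_states m. f x)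
      = (\<Sum>x\<in>{Idle m, Idle (m + 1)}. f x) + ((\<Sum>x\<in>?B m. f x) + (\<Sum>x\<in>?B (m + 1). f x))"
    unfolding states
    by (subst sum.union_disjoint, simp, simp, force)+ (rule refl)
  then show ?thesis by (simp only: block) simp
qed

lemma finite_pull_states: "finite (pull_states m :: 'n::finite state set)"
proof -
  have "pull_states m \<subseteq> {Idle m, Idle (m + 1)}
      \<union> (\<lambda>(q, e, j). Busy q e j) ` ({1..m+1} \<times> {m, m + 1} \<times> (UNIV :: 'n set))"
    by (auto simp: pull_states_def image_iff)
  then show ?thesis by (rule finite_subset) auto
qed

text \<open>Normal form for the rates: a kind of transition singles out one level \<open>a\<close>
  and carries a side condition \<open>P\<close>, so at most one level survives in the double
  sum.\<close>

lemma sum_if_eq_outer: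
  fixes a :: nat
  shows "(\<Sum>q\<in>{1..N}. \<Sum>j\<in>A. if q = a \<and> P then f q j else (0::real))
    = (if P \<and> a \<in> {1..N} then \<Sum>j\<in>A. f a j else 0)"
proof -
  have "(\<Sum>q\<in>{1..N}. \<Sum>j\<in>A. if q = a \<and> P then f q j else 0)
      = (\<Sum>q\<in>{1..N}. if q = a then (if P then \<Sum>j\<in>A. f q j else 0) else 0)"
    by (intro sum.cong) auto
  then show ?thesis by simp
qed

lemma sum_split_first: "(\<Sum>q=1..Suc m. f q) = f 1 + (\<Sum>q=1..m. f (Suc q))"
  for f :: "nat \<Rightarrow> 'a::comm_monoid_add"
  by (induction m) (simp_all add: add.assoc)

lemma sum_vector_matrix_mult: "(\<Sum>q\<in>Q. x q) v* A = (\<Sum>q\<in>Q. x q v* A)"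
  for A :: "real^'n^'m"
  by (induction Q rule: infinite_finite_induct) (simp_all add: vector_matrix_left_distrib)

lemma scaleR_vector_matrix_mult: "(c *\<^sub>R x) v* A = c *\<^sub>R (x v* A)"
  for A :: "real^'n^'m"
  by (simp add: vector_matrix_mult_def vec_eq_iff sum_distrib_left algebra_simps)

lemma sum_power_reverse: "(\<Sum>q=1..m. x ^ (m - q)) * (1 - x) = 1 - x ^ m" for x :: real
proof (induction m)
  case (Suc m)
  have "(\<Sum>q=1..Suc m. x ^ (Suc m - q)) = x ^ m + (\<Sum>q=1..m. x ^ (m - q))"
    by (simp only: sum_split_first) simp
  then show ?case using Suc by (simp only: distrib_right) (simp add: algebra_simps)
qed simp

subsection \<open>Resolvents and the transform of the job size\<close>

locale pull_policy =
  fixes \<alpha> :: "real^'n" and S :: "real^'n^'n" and \<delta>\<^sub>1 \<delta>\<^sub>0 :: real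
  assumes \<delta>\<^sub>1_pos: "0 < \<delta>\<^sub>1" and \<delta>\<^sub>1_less: "\<delta>\<^sub>1 < 1" and \<delta>\<^sub>0_pos: "0 < \<delta>\<^sub>0"
    and phase_type: "phase_type \<alpha> S" and mean: "phase_type_mean \<alpha> S = 1"
begin

lemma \<alpha>_nonneg: "0 \<le> \<alpha> $ j" and sum_\<alpha>: "(\<Sum>j\<in>UNIV. \<alpha> $ j) = 1"
  and subgen: "subgenerator S" and invertible_S: "invertible S"
  using phase_type by (auto simp: phase_type_def)

lemma \<alpha>_one: "\<alpha> \<bullet> 1 = 1"
  using sum_\<alpha> by (simp add: inner_vec_def)

lemma \<alpha>_nonzero: "\<alpha> \<noteq> 0"
  using \<alpha>_one by auto

definition resolvent :: "real \<Rightarrow> real^'n^'n" where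
  "resolvent \<nu> = matrix_inv (mat \<nu> - S)"

text \<open>The Laplace-Stieltjes transform of the job size distribution.\<close>

definition lst :: "real \<Rightarrow> real" where
  "lst \<nu> = \<alpha> \<bullet> (resolvent \<nu> *v exit_rate S)"

text \<open>Inverse positivity: killing at rate \<nu> leaves \<open>S - mat \<nu>\<close> a
  subgenerator from which all phases exit, so the minimum principle applies.\<close>

lemma shift_monotone:
  assumes "0 \<le> \<nu>" and "\<And>i. 0 \<le> ((mat \<nu> - S) *v v) $ i"
  shows "0 \<le> v $ i"
proof (rule subgenerator_monotone)
  show "subgenerator (S - mat \<nu>)" by (intro subgenerator_shift subgen assms)
  show "all_phases_exit (S - mat \<nu>)"
    by (intro all_phases_exit_shift invertible_imp_all_phases_exit subgen invertible_S assms)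
  show "((S - mat \<nu>) *v v) $ i \<le> 0" for i
    using assms(2)[of i] by (simp add: matrix_vector_mult_diff_rdistrib)
qed

text \<open>A kernel vector and its negative are both nonnegative by inverse positivity.\<close>

lemma invertible_shift:
  assumes "0 \<le> \<nu>" shows "invertible (mat \<nu> - S)"
proof -
  have "v = 0" if "(mat \<nu> - S) *v v = 0" for v
  proof -
    have "0 \<le> v $ i" for i
      using shift_monotone[OF assms, of v i] that by simp
    moreover have "(mat \<nu> - S) *v (-v) = 0"
      using that by (simp add: matrix_vector_mult_def vec_eq_iff sum_negf)
    then have "0 \<le> (-v) $ i" for i
      using shift_monotone[OF assms, of "-v" i] by simp
    ultimately show "v = 0" by (simp add: vec_eq_iff antisym)
  qed
  then show ?thesis
    using invertible_left_inverse matrix_left_invertible_ker by blast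
qed

lemma shift_resolvent:
  assumes "0 \<le> \<nu>"
  shows "(mat \<nu> - S) *v (resolvent \<nu> *v b) = b"
  unfolding resolvent_def matrix_vector_mul_assoc matrix_inv_right[OF invertible_shift[OF assms]] by simp

lemma resolvent_shift:
  assumes "0 \<le> \<nu>"
  shows "resolvent \<nu> *v ((mat \<nu> - S) *v b) = b"
  unfolding resolvent_def matrix_vector_mul_assoc matrix_inv_left[OF invertible_shift[OF assms]] by simp

lemma shift_mult_eq: "(mat \<nu> - S) *v x = b \<Longrightarrow> S *v x = \<nu> *\<^sub>R x - b"
  by (auto simp: matrix_vector_mult_diff_rdistrib matrix_vector_mult_mat_real)

lemma row_solve:
  assumes "0 \<le> \<nu>"
  shows "x v* (mat \<nu> - S) = b \<longleftrightarrow> x = b v* resolvent \<nu>"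
  unfolding resolvent_def
  by (auto simp: vector_matrix_mul_assoc matrix_inv[OF invertible_shift[OF assms]])

lemma resolvent_nonneg:
  assumes "0 \<le> \<nu>" and "\<And>i. 0 \<le> b $ i"
  shows "0 \<le> (resolvent \<nu> *v b) $ i"
  by (rule shift_monotone[OF assms(1)]) (simp add: shift_resolvent assms)

lemma row_resolvent_nonneg:
  assumes "0 \<le> \<nu>" and "\<And>i. 0 \<le> b $ i"
  shows "0 \<le> (b v* resolvent \<nu>) $ j"
proof -
  have "(b v* resolvent \<nu>) $ j = b \<bullet> (resolvent \<nu> *v axis j 1)"
    by (simp add: dot_lmul_matrix[symmetric] inner_axis)
  also have "\<dots> \<ge> 0"
    by (intro inner_vec_nonneg assms resolvent_nonneg) (simp add: axis_def)
  finally show ?thesis .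
qed

lemma shift_one: "(mat \<nu> - S) *v 1 = \<nu> *\<^sub>R 1 + exit_rate S"
  by (simp add: matrix_vector_mult_diff_rdistrib matrix_vector_mult_mat_real exit_rate_def)

text \<open>Conservation of mass: what flows in as \<open>b\<close> leaves either by an assignment
  at rate \<nu> or by a completion.\<close>

lemma row_resolvent_one:
  assumes "0 \<le> \<nu>"
  shows "\<nu> * ((b v* resolvent \<nu>) \<bullet> 1) + (b v* resolvent \<nu>) \<bullet> exit_rate S = b \<bullet> 1"
proof -
  have "\<nu> * ((b v* resolvent \<nu>) \<bullet> 1) + (b v* resolvent \<nu>) \<bullet> exit_rate S
      = (b v* resolvent \<nu>) \<bullet> ((mat \<nu> - S) *v 1)"
    by (simp add: shift_one inner_add_right)
  then show ?thesis
    by (simp add: dot_lmul_matrix resolvent_shift assms)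
qed

lemma row_lst: "(\<alpha> v* resolvent \<nu>) \<bullet> exit_rate S = lst \<nu>"
  by (simp add: lst_def dot_lmul_matrix)

text \<open>The only place where the hypothesis of mean job size 1 enters directly.\<close>

lemma row_mean: "(\<alpha> v* resolvent 0) \<bullet> 1 = 1"
proof -
  have "(mat 0 - S) = - S" by (simp add: mat_def vec_eq_iff)
  then show ?thesis using mean by (simp add: phase_type_mean_def resolvent_def dot_lmul_matrix)
qed

lemma lst_0: "lst 0 = 1"
  using row_resolvent_one[of 0 \<alpha>] by (simp add: row_lst \<alpha>_one)

text \<open>Entry \<open>i\<close> is the transform of a job started in phase \<open>i\<close>. At a
  zero, the resolvent equation rules out both a positive exit rate and a jump to a phase with
  positive entry, so the set of zeros would be closed without exit.\<close>

lemma resolvent_exit_pos: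
  assumes "0 \<le> \<nu>" shows "0 < (resolvent \<nu> *v exit_rate S) $ i"
proof (rule ccontr)
  define v where "v = resolvent \<nu> *v exit_rate S"
  assume "\<not> 0 < (resolvent \<nu> *v exit_rate S) $ i"
  have nn: "0 \<le> v $ j" for j
    unfolding v_def by (intro resolvent_nonneg assms exit_rate_nonneg subgen)
  have "v $ i = 0"
    using \<open>\<not> 0 < _\<close> nn[of i] unfolding v_def by simp
  then obtain k where k: "v $ k = 0"
    "(\<Sum>j\<in>UNIV. S $ k $ j) < 0 \<or> (\<exists>j. v $ j \<noteq> 0 \<and> 0 < S $ k $ j)"
    using all_phases_exitD[OF invertible_imp_all_phases_exit[OF subgen invertible_S], of "\<lambda>k. v $ k = 0" i]
    by blast
  have "((mat \<nu> - S) *v v) $ k = exit_rate S $ k"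
    unfolding v_def by (simp add: shift_resolvent assms)
  then have eq: "exit_rate S $ k + (\<Sum>j\<in>UNIV. S $ k $ j * v $ j) = 0"
    using k(1) by (simp add: matrix_vector_mult_diff_rdistrib matrix_vector_mult_mat_real) (simp add: matrix_vector_mult_def)
  have off: "0 \<le> S $ k $ j * v $ j" for j
    using subgen nn[of j] k(1) unfolding subgenerator_def by (cases "j = k") auto
  have "0 < exit_rate S $ k + (\<Sum>j\<in>UNIV. S $ k $ j * v $ j)"
    using k(2)
  proof
    assume "(\<Sum>j\<in>UNIV. S $ k $ j) < 0"
    then have "0 < exit_rate S $ k" by (simp add: exit_rate_nth)
    then show ?thesis by (intro add_pos_nonneg sum_nonneg off)
  next
    assume "\<exists>j. v $ j \<noteq> 0 \<and> 0 < S $ k $ j"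
    then obtain j where "v $ j \<noteq> 0" "0 < S $ k $ j" by blast
    then have "0 < S $ k $ j * v $ j" using nn[of j] by simp
    then have "0 < (\<Sum>j\<in>UNIV. S $ k $ j * v $ j)"
      by (intro sum_pos2[of _ j]) (auto simp: off)
    then show ?thesis using exit_rate_nonneg[OF subgen, of k] by simp
  qed
  then show False using eq by simp
qed

lemma lst_pos:
  assumes "0 \<le> \<nu>" shows "0 < lst \<nu>"
proof -
  obtain j where "\<alpha> $ j \<noteq> 0" using \<alpha>_nonzero by (auto simp: vec_eq_iff)
  then have "0 < \<alpha> $ j" using \<alpha>_nonneg[of j] by simp
  then show ?thesis
    unfolding lst_def inner_vec_def using resolvent_exit_pos[OF assms] \<alpha>_nonneg
    by (intro sum_pos2[of _ j]) (auto intro!: mult_nonneg_nonneg mult_pos_pos intro: less_imp_le)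
qed

text \<open>\<open>mat \<mu> - S\<close> maps the difference of the two vectors to \<mu> - \<nu>
  times the nonnegative vector at \<nu>, so inverse positivity applies.\<close>

lemma resolvent_exit_antimono:
  assumes "0 \<le> \<nu>" "\<nu> \<le> \<mu>"
  shows "(resolvent \<mu> *v exit_rate S) $ i \<le> (resolvent \<nu> *v exit_rate S) $ i"
proof -
  define v where "v = resolvent \<nu> *v exit_rate S"
  have "(mat \<mu> - S) *v v = (mat \<nu> - S) *v v + (\<mu> - \<nu>) *\<^sub>R v"
    by (simp add: matrix_vector_mult_diff_rdistrib matrix_vector_mult_mat_real algebra_simps)
  also have "(mat \<nu> - S) *v v = exit_rate S"
    unfolding v_def by (simp add: shift_resolvent assms)
  finally have "(mat \<mu> - S) *v (v - resolvent \<mu> *v exit_rate S) = (\<mu> - \<nu>) *\<^sub>R v"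
    using assms by (simp add: matrix_vector_mult_diff_distrib shift_resolvent)
  moreover have "0 \<le> v $ j" for j
    unfolding v_def using resolvent_exit_pos[OF assms(1)] by (simp add: less_imp_le)
  ultimately have "0 \<le> ((mat \<mu> - S) *v (v - resolvent \<mu> *v exit_rate S)) $ j" for j
    using assms by simp
  then have "0 \<le> (v - resolvent \<mu> *v exit_rate S) $ i"
    by (rule shift_monotone[OF order_trans[OF assms]])
  then show ?thesis by (simp add: v_def)
qed

lemma lst_antimono:
  assumes "0 \<le> \<nu>" "\<nu> \<le> \<mu>" shows "lst \<mu> \<le> lst \<nu>"
  unfolding lst_def inner_vec_def
  using \<alpha>_nonneg resolvent_exit_antimono[OF assms] by (auto intro!: sum_mono mult_left_mono)

lemma lst_le_1: "0 \<le> \<nu> \<Longrightarrow> lst \<nu> \<le> 1"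
  using lst_antimono[of 0 \<nu>] by (simp add: lst_0)

lemma resolvent_exit_le_1: 
  assumes "0 \<le> \<nu>" shows "(resolvent \<nu> *v exit_rate S) $ i \<le> 1"
proof -
  have "resolvent 0 *v exit_rate S = 1"
    using resolvent_shift[of 0 1, unfolded shift_one] by simp
  then show ?thesis using resolvent_exit_antimono[of 0 \<nu> i] assms by simp
qed

text \<open>The Lipschitz constant is the mean job size. The entries of \<open>h\<close> are the
  mean remaining job sizes by phase; inverse positivity bounds \<open>a - b\<close> by \<mu> - \<nu>
  times \<open>h\<close>, and averaging over \<alpha> gives the claim.\<close>

lemma lst_lipschitz:
  assumes "0 \<le> \<nu>" "\<nu> \<le> \<mu>" shows "lst \<nu> - lst \<mu> \<le> \<mu> - \<nu>"
proof -
  define a where "a = resolvent \<nu> *v exit_rate S"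
  define b where "b = resolvent \<mu> *v exit_rate S"
  define h where "h = resolvent 0 *v 1"
  have eqs: "S *v a = \<nu> *\<^sub>R a - exit_rate S" "S *v b = \<mu> *\<^sub>R b - exit_rate S" "S *v h = - 1"
    using shift_mult_eq[OF shift_resolvent, of \<nu> "exit_rate S"] 
      shift_mult_eq[OF shift_resolvent, of \<mu> "exit_rate S"]
      shift_mult_eq[OF shift_resolvent, of 0 1] assms
    by (simp_all add: a_def b_def h_def)
  have neg: "(- S) *v x = - (S *v x)" for x
    by (simp add: matrix_vector_mult_def vec_eq_iff sum_negf)
  have le: "b $ i \<le> a $ i" "a $ i \<le> 1" "0 \<le> b $ i" for i
    using resolvent_exit_antimono[OF assms] resolvent_exit_le_1 resolvent_exit_pos assms
    by (auto simp: a_def b_def intro: less_imp_le)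
  have "0 \<le> ((\<mu> - \<nu>) *\<^sub>R h - (a - b)) $ i" for i
  proof (rule shift_monotone[of 0])
    fix i
    have "((mat 0 - S) *v ((\<mu> - \<nu>) *\<^sub>R h - (a - b))) $ i = (\<mu> - \<nu>) + \<nu> * a $ i - \<mu> * b $ i"
      by (simp add: matrix_vector_mult_diff_distrib matrix_vector_mult_diff_rdistrib
          matrix_vector_mult_scaleR neg eqs)
    also have "\<dots> = (\<mu> - \<nu>) * (1 - b $ i) + \<nu> * (a $ i - b $ i)"
      by (simp add: algebra_simps)
    also have "\<dots> \<ge> 0" using le[of i] assms by (intro add_nonneg_nonneg mult_nonneg_nonneg) auto
    finally show "0 \<le> ((mat 0 - S) *v ((\<mu> - \<nu>) *\<^sub>R h - (a - b))) $ i" .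
  qed simp
  then have "0 \<le> \<alpha> \<bullet> ((\<mu> - \<nu>) *\<^sub>R h - (a - b))"
    by (intro inner_vec_nonneg \<alpha>_nonneg)
  moreover have "\<alpha> \<bullet> h = 1" using row_mean by (simp add: h_def dot_lmul_matrix)
  ultimately show ?thesis
    by (simp add: lst_def a_def b_def inner_diff_right)
qed

lemma continuous_on_lst: "continuous_on {0..} lst"
proof (rule continuous_onI)
  fix x e :: real assume "x \<in> {0..}" "0 < e"
  have "\<bar>lst y - lst x\<bar> \<le> \<bar>y - x\<bar>" if "0 \<le> y" for y
    using lst_lipschitz[of x y] lst_lipschitz[of y x] lst_antimono[of x y] lst_antimono[of y x]
      \<open>x \<in> {0..}\<close> that by (cases "x \<le> y") auto
  then show "\<exists>d>0. \<forall>x'\<in>{0..}. dist x' x < d \<longrightarrow> dist (lst x') (lst x) \<le> e"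
    using \<open>0 < e\<close> by (intro exI[of _ e]) (force simp: dist_real_def)
qed

subsection \<open>Global balance as a triangular system\<close>

abbreviation rate :: "nat \<Rightarrow> real \<Rightarrow> 'n state \<Rightarrow> 'n state \<Rightarrow> real" where
  "rate \<equiv> pull_rate \<alpha> S \<delta>\<^sub>1 \<delta>\<^sub>0"

definition phase_vec :: "('n state \<Rightarrow> real) \<Rightarrow> nat \<Rightarrow> nat \<Rightarrow> real^'n" where
  "phase_vec g q e = (\<chi> j. g (Busy q e j))"

text \<open>The completion rate of a level, counting completions both with and without
  update.\<close>

definition flux :: "('n state \<Rightarrow> real) \<Rightarrow> nat \<Rightarrow> nat \<Rightarrow> real" where
  "flux g q e = phase_vec g q e \<bullet> exit_rate S"

definition update_rate :: "nat \<Rightarrow> ('n state \<Rightarrow> real) \<Rightarrow> real" where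
  "update_rate m g = \<delta>\<^sub>1 * ((\<Sum>q=1..m. flux g q m) + (\<Sum>q=1..m+1. flux g q (m + 1)))
     + \<delta>\<^sub>0 * (g (Idle m) + g (Idle (m + 1)))"

text \<open>
  The update rate \<open>u\<close> is a parameter of the system so that it becomes triangular. An idle server
  with \<open>m = 0\<close> takes the place of the top level \<open>(m,m)\<close>, and \<open>\<delta>\<^sub>0 g(Idle 0)\<close> in the update rate is
  then the self-transition at \<open>Idle 0\<close>.
\<close>

definition balanced :: "nat \<Rightarrow> real \<Rightarrow> real \<Rightarrow> ('n state \<Rightarrow> real) \<Rightarrow> bool" where
  "balanced m \<nu> u g \<longleftrightarrow>
     (\<forall>q\<in>{1..m}. phase_vec g q m v* (mat \<nu> - S)
        = (if q = m then u else (1 - \<delta>\<^sub>1) * flux g (q + 1) m) *\<^sub>R \<alpha>) \<and>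
     (\<nu> + \<delta>\<^sub>0) * g (Idle m) = (if m = 0 then u else (1 - \<delta>\<^sub>1) * flux g 1 m) \<and>
     (\<forall>q\<in>{1..m+1}. phase_vec g q (m + 1) v* (- S)
        = (if q = 1 then (\<nu> * g (Idle m)) *\<^sub>R \<alpha> else \<nu> *\<^sub>R phase_vec g (q - 1) m)
          + (if q \<le> m then (1 - \<delta>\<^sub>1) * flux g (q + 1) (m + 1) else 0) *\<^sub>R \<alpha>) \<and>
     \<delta>\<^sub>0 * g (Idle (m + 1)) = (1 - \<delta>\<^sub>1) * flux g 1 (m + 1)"

section \<open>Inflow and outflow of single states\<close>

lemma flux_sum: "flux g q e = (\<Sum>i\<in>UNIV. g (Busy q e i) * exit_rate S $ i)"
  by (simp add: flux_def phase_vec_def inner_vec_def)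

lemma off_diagonal_row: "(\<Sum>j\<in>UNIV. if j \<noteq> i then S $ i $ j else 0) = - exit_rate S $ i - S $ i $ i"
proof -
  have "(\<Sum>j\<in>UNIV. if j \<noteq> i then S $ i $ j else 0) = (\<Sum>j\<in>UNIV. S $ i $ j - (if j = i then S $ i $ j else 0))"
    by (intro sum.cong) auto
  then show ?thesis by (simp add: sum_subtractf exit_rate_nth)
qed

lemma off_diagonal_column:
  "(\<Sum>i\<in>UNIV. g (Busy q e i) * (if j \<noteq> i then S $ i $ j else 0))
    = (phase_vec g q e v* S) $ j - g (Busy q e j) * S $ j $ j"
proof -
  have "(\<Sum>i\<in>UNIV. g (Busy q e i) * (if j \<noteq> i then S $ i $ j else 0))
      = (\<Sum>i\<in>UNIV. g (Busy q e i) * S $ i $ j - (if i = j then g (Busy q e i) * S $ i $ j else 0))"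
    by (intro sum.cong) auto
  then show ?thesis
    by (simp add: sum_subtractf vector_matrix_mult_def phase_vec_def mult.commute)
qed

text \<open>The summands match those of \<open>pull_rate\<close>: phase changes, completions without
  and with update, assignments. The height \<open>N\<close> of the block is free so that both
  estimates are covered.\<close>

lemma busy_block_inflow:
  assumes "1 \<le> q'"
  shows "(\<Sum>q=1..N. \<Sum>i\<in>UNIV. g (Busy q e i) * rate m \<nu> (Busy q e i) (Busy q' e' j')) =
    (if e' = e \<and> q' \<le> N then (phase_vec g q' e v* S) $ j' - g (Busy q' e j') * S $ j' $ j' else 0)
    + (if e' = e \<and> q' + 1 \<le> N then (1 - \<delta>\<^sub>1) * flux g (q' + 1) e * \<alpha> $ j' else 0)
    + (if 1 \<le> m \<and> q' = m \<and> e' = m then \<delta>\<^sub>1 * (\<Sum>q=1..N. flux g q e) * \<alpha> $ j' else 0)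
    + (if e = m \<and> e' = m + 1 \<and> 2 \<le> q' \<and> q' \<le> N + 1 then \<nu> * g (Busy (q' - 1) e j') else 0)"
    (is "_ = ?r1 + ?r2 + ?r3 + ?r4")
proof -
  have 1: "(\<Sum>q=1..N. \<Sum>i\<in>UNIV. g (Busy q e i) * (if q' = q \<and> e' = e \<and> j' \<noteq> i then S $ i $ j' else 0)) = ?r1"
  proof -
    have "(\<Sum>q=1..N. \<Sum>i\<in>UNIV. g (Busy q e i) * (if q' = q \<and> e' = e \<and> j' \<noteq> i then S $ i $ j' else 0))
        = (\<Sum>q=1..N. \<Sum>i\<in>UNIV. if q = q' \<and> e' = e then g (Busy q e i) * (if j' \<noteq> i then S $ i $ j' else 0) else 0)"
      by (intro sum.cong) auto
    then show ?thesis using assms by (simp only: sum_if_eq_outer off_diagonal_column) auto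
  qed
  have 2: "(\<Sum>q=1..N. \<Sum>i\<in>UNIV. g (Busy q e i) *
      (if q \<ge> 2 \<and> q' = q - 1 \<and> e' = e then (1 - \<delta>\<^sub>1) * exit_rate S $ i * \<alpha> $ j' else 0)) = ?r2"
  proof -
    have "(\<Sum>q=1..N. \<Sum>i\<in>UNIV. g (Busy q e i) *
        (if q \<ge> 2 \<and> q' = q - 1 \<and> e' = e then (1 - \<delta>\<^sub>1) * exit_rate S $ i * \<alpha> $ j' else 0))
      = (\<Sum>q=1..N. \<Sum>i\<in>UNIV. if q = q' + 1 \<and> e' = e then (1 - \<delta>\<^sub>1) * (g (Busy q e i) * exit_rate S $ i) * \<alpha> $ j' else 0)"
      using assms by (intro sum.cong) (auto simp: algebra_simps)
    then show ?thesis
      by (simp only: sum_if_eq_outer) (auto simp: flux_sum sum_distrib_left sum_distrib_right)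
  qed
  have 3: "(\<Sum>q=1..N. \<Sum>i\<in>UNIV. g (Busy q e i) *
      (if m \<ge> 1 \<and> q' = m \<and> e' = m then \<delta>\<^sub>1 * exit_rate S $ i * \<alpha> $ j' else 0)) = ?r3"
    by (auto simp: flux_sum sum_distrib_left sum_distrib_right algebra_simps)
  have 4: "(\<Sum>q=1..N. \<Sum>i\<in>UNIV. g (Busy q e i) *
      (if e = m \<and> q' = q + 1 \<and> e' = m + 1 \<and> j' = i then \<nu> else 0)) = ?r4"
  proof -
    have "(\<Sum>q=1..N. \<Sum>i\<in>UNIV. g (Busy q e i) *
      (if e = m \<and> q' = q + 1 \<and> e' = m + 1 \<and> j' = i then \<nu> else 0))
      = (\<Sum>q=1..N. \<Sum>i\<in>UNIV. if q = q' - 1 \<and> (e = m \<and> e' = m + 1 \<and> 2 \<le> q') then (if i = j' then \<nu> * g (Busy q e i) else 0) else 0)"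
      by (intro sum.cong) auto
    then show ?thesis
      by (simp only: sum_if_eq_outer) auto
  qed
  show ?thesis
    unfolding pull_rate.simps distrib_left sum.distrib 1 2 3 4 ..
qed

lemma busy_block_outflow:
  "(\<Sum>q'=1..N. \<Sum>j'\<in>UNIV. rate m \<nu> (Busy q e j) (Busy q' e' j')) =
    (if e' = e \<and> 1 \<le> q \<and> q \<le> N then - exit_rate S $ j - S $ j $ j else 0)
    + (if e' = e \<and> 2 \<le> q \<and> q \<le> N + 1 then (1 - \<delta>\<^sub>1) * exit_rate S $ j else 0)
    + (if e' = m \<and> 1 \<le> m \<and> m \<le> N then \<delta>\<^sub>1 * exit_rate S $ j else 0)
    + (if e = m \<and> e' = m + 1 \<and> q + 1 \<le> N then \<nu> else 0)"
    (is "_ = ?r1 + ?r2 + ?r3 + ?r4")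
proof -
  have 1: "(\<Sum>q'=1..N. \<Sum>j'\<in>UNIV. if q' = q \<and> e' = e \<and> j' \<noteq> j then S $ j $ j' else 0) = ?r1"
  proof -
    have "(\<Sum>q'=1..N. \<Sum>j'\<in>UNIV. if q' = q \<and> e' = e \<and> j' \<noteq> j then S $ j $ j' else 0)
      = (\<Sum>q'=1..N. \<Sum>j'\<in>UNIV. if q' = q \<and> e' = e then (if j' \<noteq> j then S $ j $ j' else 0) else 0)"
      by (intro sum.cong) auto
    then show ?thesis by (simp only: sum_if_eq_outer off_diagonal_row) auto
  qed
  have 2: "(\<Sum>q'=1..N. \<Sum>j'\<in>UNIV. if q \<ge> 2 \<and> q' = q - 1 \<and> e' = e then (1 - \<delta>\<^sub>1) * exit_rate S $ j * \<alpha> $ j' else 0) = ?r2"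
  proof -
    have "(\<Sum>q'=1..N. \<Sum>j'\<in>UNIV. if q \<ge> 2 \<and> q' = q - 1 \<and> e' = e then (1 - \<delta>\<^sub>1) * exit_rate S $ j * \<alpha> $ j' else 0)
      = (\<Sum>q'=1..N. \<Sum>j'\<in>UNIV. if q' = q - 1 \<and> (q \<ge> 2 \<and> e' = e) then (1 - \<delta>\<^sub>1) * exit_rate S $ j * \<alpha> $ j' else 0)"
      by (intro sum.cong) auto
    then show ?thesis
      by (simp only: sum_if_eq_outer) (auto simp: sum_distrib_left[symmetric] sum_\<alpha>)
  qed
  have 3: "(\<Sum>q'=1..N. \<Sum>j'\<in>UNIV. if m \<ge> 1 \<and> q' = m \<and> e' = m then \<delta>\<^sub>1 * exit_rate S $ j * \<alpha> $ j' else 0) = ?r3"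
  proof -
    have "(\<Sum>q'=1..N. \<Sum>j'\<in>UNIV. if m \<ge> 1 \<and> q' = m \<and> e' = m then \<delta>\<^sub>1 * exit_rate S $ j * \<alpha> $ j' else 0)
      = (\<Sum>q'=1..N. \<Sum>j'\<in>UNIV. if q' = m \<and> (m \<ge> 1 \<and> e' = m) then \<delta>\<^sub>1 * exit_rate S $ j * \<alpha> $ j' else 0)"
      by (intro sum.cong) auto
    then show ?thesis
      by (simp only: sum_if_eq_outer) (auto simp: sum_distrib_left[symmetric] sum_\<alpha>)
  qed
  have 4: "(\<Sum>q'=1..N. \<Sum>j'\<in>UNIV. if e = m \<and> q' = q + 1 \<and> e' = m + 1 \<and> j' = j then \<nu> else 0) = ?r4"
  proof -
    have "(\<Sum>q'=1..N. \<Sum>j'\<in>UNIV. if e = m \<and> q' = q + 1 \<and> e' = m + 1 \<and> j' = j then \<nu> else 0)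
      = (\<Sum>q'=1..N. \<Sum>j'\<in>UNIV. if q' = q + 1 \<and> (e = m \<and> e' = m + 1) then (if j' = j then \<nu> else 0) else 0)"
      by (intro sum.cong) auto
    then show ?thesis
      by (simp only: sum_if_eq_outer) auto
  qed
  show ?thesis
    unfolding pull_rate.simps sum.distrib 1 2 3 4 ..
qed

lemma idle_block_outflow:
  "(\<Sum>q'=1..N. \<Sum>j'\<in>UNIV. rate m \<nu> (Idle e) (Busy q' e' j')) =
    (if e' = m \<and> 1 \<le> m \<and> m \<le> N then \<delta>\<^sub>0 else 0) + (if e = m \<and> e' = m + 1 \<and> 1 \<le> N then \<nu> else 0)"
    (is "_ = ?r1 + ?r2")
proof -
  have 1: "(\<Sum>q'=1..N. \<Sum>j'\<in>UNIV. if m \<ge> 1 \<and> q' = m \<and> e' = m then \<delta>\<^sub>0 * \<alpha> $ j' else 0) = ?r1"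
  proof -
    have "(\<Sum>q'=1..N. \<Sum>j'\<in>UNIV. if m \<ge> 1 \<and> q' = m \<and> e' = m then \<delta>\<^sub>0 * \<alpha> $ j' else 0)
      = (\<Sum>q'=1..N. \<Sum>j'\<in>UNIV. if q' = m \<and> (m \<ge> 1 \<and> e' = m) then \<delta>\<^sub>0 * \<alpha> $ j' else 0)"
      by (intro sum.cong) auto
    then show ?thesis
      by (simp only: sum_if_eq_outer) (auto simp: sum_distrib_left[symmetric] sum_\<alpha>)
  qed
  have 2: "(\<Sum>q'=1..N. \<Sum>j'\<in>UNIV. if e = m \<and> q' = 1 \<and> e' = m + 1 then \<nu> * \<alpha> $ j' else 0) = ?r2"
  proof -
    have "(\<Sum>q'=1..N. \<Sum>j'\<in>UNIV. if e = m \<and> q' = 1 \<and> e' = m + 1 then \<nu> * \<alpha> $ j' else 0)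
      = (\<Sum>q'=1..N. \<Sum>j'\<in>UNIV. if q' = 1 \<and> (e = m \<and> e' = m + 1) then \<nu> * \<alpha> $ j' else 0)"
      by (intro sum.cong) auto
    then show ?thesis
      by (simp only: sum_if_eq_outer) (auto simp: sum_distrib_left[symmetric] sum_\<alpha>)
  qed
  show ?thesis
    unfolding pull_rate.simps sum.distrib 1 2 ..
qed

lemma busy_idle_inflow:
  "(\<Sum>q=1..N. \<Sum>i\<in>UNIV. g (Busy q e i) * rate m \<nu> (Busy q e i) (Idle e')) =
    (if e' = e \<and> 1 \<le> N then (1 - \<delta>\<^sub>1) * flux g 1 e else 0)
    + (if m = 0 \<and> e = 1 \<and> e' = 0 \<and> 1 \<le> N then \<delta>\<^sub>1 * flux g 1 e else 0)"
    (is "_ = ?r1 + ?r2")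
proof -
  have 1: "(\<Sum>q=1..N. \<Sum>i\<in>UNIV. g (Busy q e i) * (if q = 1 \<and> e' = e then (1 - \<delta>\<^sub>1) * exit_rate S $ i else 0)) = ?r1"
  proof -
    have "(\<Sum>q=1..N. \<Sum>i\<in>UNIV. g (Busy q e i) * (if q = 1 \<and> e' = e then (1 - \<delta>\<^sub>1) * exit_rate S $ i else 0))
      = (\<Sum>q=1..N. \<Sum>i\<in>UNIV. if q = 1 \<and> e' = e then (1 - \<delta>\<^sub>1) * (g (Busy q e i) * exit_rate S $ i) else 0)"
      by (intro sum.cong) auto
    then show ?thesis
      by (simp only: sum_if_eq_outer) (auto simp: flux_sum sum_distrib_left)
  qed
  have 2: "(\<Sum>q=1..N. \<Sum>i\<in>UNIV. g (Busy q e i) * (if m = 0 \<and> q = 1 \<and> e = 1 \<and> e' = 0 then \<delta>\<^sub>1 * exit_rate S $ i else 0)) = ?r2"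
  proof -
    have "(\<Sum>q=1..N. \<Sum>i\<in>UNIV. g (Busy q e i) * (if m = 0 \<and> q = 1 \<and> e = 1 \<and> e' = 0 then \<delta>\<^sub>1 * exit_rate S $ i else 0))
      = (\<Sum>q=1..N. \<Sum>i\<in>UNIV. if q = 1 \<and> (m = 0 \<and> e = 1 \<and> e' = 0) then \<delta>\<^sub>1 * (g (Busy q e i) * exit_rate S $ i) else 0)"
      by (intro sum.cong) auto
    then show ?thesis
      by (simp only: sum_if_eq_outer) (auto simp: flux_sum sum_distrib_left)
  qed
  show ?thesis
    unfolding pull_rate.simps distrib_left sum.distrib 1 2 ..
qed

text \<open>The two kinds of completion add up to the full exit rate at every level because \<alpha>
  sums to 1, and this cancels against the phase changes down to the diagonal entry. Completions
  leading back to the same state are counted here as in the inflow.\<close>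

lemma outflow_busy:
  assumes "e \<in> {m, m + 1}" "1 \<le> q" "q \<le> e"
  shows "(\<Sum>z\<in>pull_states m. rate m \<nu> (Busy q e j) z) = - S $ j $ j + (if e = m then \<nu> else 0)"
  unfolding sum_pull_states busy_block_outflow
  using assms by (cases "q = 1"; cases "e = m"; cases "m = 0") (auto simp: algebra_simps)

lemma outflow_idle:
  assumes "e \<in> {m, m + 1}"
  shows "(\<Sum>z\<in>pull_states m. rate m \<nu> (Idle e) z) = \<delta>\<^sub>0 + (if e = m then \<nu> else 0)"
  unfolding sum_pull_states idle_block_outflow
  using assms by auto

lemma inflow_busy_low:
  assumes "1 \<le> q" "q \<le> m"
  shows "(\<Sum>x\<in>pull_states m. g x * rate m \<nu> x (Busy q m j)) =
    (phase_vec g q m v* S) $ j - g (Busy q m j) * S $ j $ j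
    + (if q = m then update_rate m g else (1 - \<delta>\<^sub>1) * flux g (q + 1) m) * \<alpha> $ j"
  unfolding sum_pull_states busy_block_inflow[OF assms(1)] update_rate_def
  using assms by (auto simp: algebra_simps)

lemma inflow_busy_high:
  assumes "1 \<le> q" "q \<le> m + 1"
  shows "(\<Sum>x\<in>pull_states m. g x * rate m \<nu> x (Busy q (m + 1) j)) =
    (phase_vec g q (m + 1) v* S) $ j - g (Busy q (m + 1) j) * S $ j $ j
    + ((if q = 1 then (\<nu> * g (Idle m)) *\<^sub>R \<alpha> else \<nu> *\<^sub>R phase_vec g (q - 1) m) $ j
    + (if q \<le> m then (1 - \<delta>\<^sub>1) * flux g (q + 1) (m + 1) else 0) * \<alpha> $ j)"
  unfolding sum_pull_states busy_block_inflow[OF assms(1)]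
  using assms by (auto simp: phase_vec_def algebra_simps)

lemma inflow_idle_low:
  "(\<Sum>x\<in>pull_states m. g x * rate m \<nu> x (Idle m)) = (if m = 0 then update_rate m g else (1 - \<delta>\<^sub>1) * flux g 1 m)"
  unfolding sum_pull_states busy_idle_inflow update_rate_def
  by (auto simp: algebra_simps)

lemma inflow_idle_high:
  "(\<Sum>x\<in>pull_states m. g x * rate m \<nu> x (Idle (m + 1))) = (1 - \<delta>\<^sub>1) * flux g 1 (m + 1)"
  unfolding sum_pull_states busy_idle_inflow
  by auto

lemma ball_pull_states:
  "(\<forall>y\<in>pull_states m. P y) \<longleftrightarrow> P (Idle m) \<and> P (Idle (m + 1))
     \<and> (\<forall>q\<in>{1..m}. \<forall>j. P (Busy q m j)) \<and> (\<forall>q\<in>{1..m+1}. \<forall>j. P (Busy q (m + 1) j))"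
  by (auto simp: pull_states_def)

text \<open>The diagonal entries of \<open>S\<close> occur in inflow and outflow and cancel, so the
  balance equations of one level combine to one row-vector equation.\<close>

lemma balance_iff:
  "(\<forall>y\<in>pull_states m. (\<Sum>x\<in>pull_states m. g x * rate m \<nu> x y) = g y * (\<Sum>z\<in>pull_states m. rate m \<nu> y z))
    \<longleftrightarrow> balanced m \<nu> (update_rate m g) g"
proof -
  have low: "(\<forall>j. (\<Sum>x\<in>pull_states m. g x * rate m \<nu> x (Busy q m j))
        = g (Busy q m j) * (\<Sum>z\<in>pull_states m. rate m \<nu> (Busy q m j) z))
      \<longleftrightarrow> phase_vec g q m v* (mat \<nu> - S)
        = (if q = m then update_rate m g else (1 - \<delta>\<^sub>1) * flux g (q + 1) m) *\<^sub>R \<alpha>" if "q \<in> {1..m}" for q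
  proof -
    have "(phase_vec g q m v* (mat \<nu> - S)) $ j = \<nu> * g (Busy q m j) - (phase_vec g q m v* S) $ j" for j
      by (simp add: vector_matrix_mult_diff_rdistrib vector_matrix_mult_mat_real)
        (simp add: phase_vec_def)
    then show ?thesis
      using that unfolding vec_eq_iff
      by (simp add: inflow_busy_low outflow_busy) (auto simp: algebra_simps)
  qed
  have high: "(\<forall>j. (\<Sum>x\<in>pull_states m. g x * rate m \<nu> x (Busy q (m + 1) j))
        = g (Busy q (m + 1) j) * (\<Sum>z\<in>pull_states m. rate m \<nu> (Busy q (m + 1) j) z))
      \<longleftrightarrow> phase_vec g q (m + 1) v* (- S)
        = (if q = 1 then (\<nu> * g (Idle m)) *\<^sub>R \<alpha> else \<nu> *\<^sub>R phase_vec g (q - 1) m)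
          + (if q \<le> m then (1 - \<delta>\<^sub>1) * flux g (q + 1) (m + 1) else 0) *\<^sub>R \<alpha>" if "q \<in> {1..m+1}" for q
  proof -
    have neg: "phase_vec g q (m + 1) v* (- S) = - (phase_vec g q (m + 1) v* S)"
      by (simp add: vector_matrix_mult_def vec_eq_iff sum_negf)
    have q: "1 \<le> q" "q \<le> m + 1" using that by auto
    have out: "(\<Sum>z\<in>pull_states m. rate m \<nu> (Busy q (m + 1) j) z) = - S $ j $ j" for j
      using outflow_busy[of "m + 1" m q \<nu> j] q by simp
    show ?thesis
      unfolding vec_eq_iff neg inflow_busy_high[OF q] out vector_add_component vector_uminus_component
        vector_scaleR_component real_scaleR_def
      by (intro iff_allI) linarith
  qed
  show ?thesis
    unfolding ball_pull_states inflow_idle_low inflow_idle_high balanced_def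
    using outflow_idle[of m m \<nu>] outflow_idle[of "m + 1" m \<nu>] 
    by (simp only: low high cong: ball_cong) (auto simp: algebra_simps)
qed

subsection \<open>Solution of the system\<close>

lemma row_solve_0: "x v* (- S) = b \<longleftrightarrow> x = b v* resolvent 0"
  using row_solve[of 0 x b] by simp

text \<open>
  \<open>idle_weight m \<nu>\<close> is the probability that, without updates at completions, \<open>m\<close> jobs and the
  following idle period all end before an assignment.
\<close>

definition idle_weight :: "nat \<Rightarrow> real \<Rightarrow> real" where
  "idle_weight m \<nu> = lst \<nu> ^ m * \<delta>\<^sub>0 / (\<nu> + \<delta>\<^sub>0)"

text \<open>
  The completion rate at \<open>(q,m+1)\<close> if the update rate is \<open>1\<close>. It comes from level crossing:
  the total completion rate at \<open>(q,m+1)\<close> and \<open>(q-1,m)\<close> is \<open>(1 - \<delta>\<^sub>1)\<^bsup>m+1-q\<^esup>\<close>,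
  where for \<open>q = 1\<close> the idle updates at \<open>(0,m)\<close> count as completions.
\<close>

definition high_flux :: "nat \<Rightarrow> real \<Rightarrow> nat \<Rightarrow> real" where
  "high_flux m \<nu> q = (if q = 1 then (1 - \<delta>\<^sub>1) ^ m * (1 - idle_weight m \<nu>)
     else (1 - \<delta>\<^sub>1) ^ (m + 1 - q) * (1 - lst \<nu> ^ (m + 2 - q)))"

text \<open>Each level below the top costs one completion without update that precedes the next
  assignment, hence one factor \<open>(1 - \<delta>\<^sub>1) * lst \<nu>\<close>.\<close>

definition low_vec :: "nat \<Rightarrow> real \<Rightarrow> nat \<Rightarrow> real^'n" where
  "low_vec m \<nu> q = ((1 - \<delta>\<^sub>1) * lst \<nu>) ^ (m - q) *\<^sub>R (\<alpha> v* resolvent \<nu>)"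

definition low_idle :: "nat \<Rightarrow> real \<Rightarrow> real" where
  "low_idle m \<nu> = ((1 - \<delta>\<^sub>1) * lst \<nu>) ^ m / (\<nu> + \<delta>\<^sub>0)"

text \<open>The right-hand side of the equation for level \<open>(q, m + 1)\<close> in
  \<open>balanced\<close>, with the closed forms inserted.\<close>

definition high_inflow :: "nat \<Rightarrow> real \<Rightarrow> nat \<Rightarrow> real^'n" where
  "high_inflow m \<nu> q = (if q = 1 then (\<nu> * low_idle m \<nu>) *\<^sub>R \<alpha> else \<nu> *\<^sub>R low_vec m \<nu> (q - 1))
     + (if q \<le> m then (1 - \<delta>\<^sub>1) * high_flux m \<nu> (q + 1) else 0) *\<^sub>R \<alpha>"

text \<open>Normalised to update rate 1, not to total mass 1; the mass is found in
  \<open>sum_solution\<close>.\<close>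

fun solution :: "nat \<Rightarrow> real \<Rightarrow> 'n state \<Rightarrow> real" where
  "solution m \<nu> (Idle e) = (if e = m then low_idle m \<nu> else (1 - \<delta>\<^sub>1) * high_flux m \<nu> 1 / \<delta>\<^sub>0)"
| "solution m \<nu> (Busy q e j) =
     (if e = m then low_vec m \<nu> q $ j else (high_inflow m \<nu> q v* resolvent 0) $ j)"

lemma idle_weight_bounds:
  assumes "0 \<le> \<nu>" shows "0 < idle_weight m \<nu>" "idle_weight m \<nu> \<le> 1"
proof -
  show "0 < idle_weight m \<nu>"
    using assms lst_pos[of \<nu>] \<delta>\<^sub>0_pos by (simp add: idle_weight_def)
  have "lst \<nu> ^ m * \<delta>\<^sub>0 \<le> 1 * \<delta>\<^sub>0"
    using assms lst_pos[of \<nu>] lst_le_1[of \<nu>] \<delta>\<^sub>0_pos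
    by (intro mult_right_mono power_le_one) auto
  also have "\<dots> \<le> \<nu> + \<delta>\<^sub>0" using assms by simp
  finally show "idle_weight m \<nu> \<le> 1"
    using assms \<delta>\<^sub>0_pos by (simp add: idle_weight_def)
qed

lemma high_flux_nonneg:
  assumes "0 \<le> \<nu>" shows "0 \<le> high_flux m \<nu> q"
  using idle_weight_bounds[OF assms, of m] \<delta>\<^sub>1_less lst_pos[OF assms] lst_le_1[OF assms]
  by (simp add: high_flux_def power_le_one)

lemma low_idle_pos: "0 \<le> \<nu> \<Longrightarrow> 0 < low_idle m \<nu>"
  using \<delta>\<^sub>1_less \<delta>\<^sub>0_pos lst_pos[of \<nu>] by (simp add: low_idle_def)

lemma low_vec_nonneg: "0 \<le> \<nu> \<Longrightarrow> 0 \<le> low_vec m \<nu> q $ j"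
  using \<delta>\<^sub>1_less lst_pos[of \<nu>] by (simp add: low_vec_def row_resolvent_nonneg \<alpha>_nonneg)

lemma high_inflow_nonneg: "0 \<le> \<nu> \<Longrightarrow> 0 \<le> high_inflow m \<nu> q $ j"
  using low_idle_pos[of \<nu> m] \<delta>\<^sub>1_less
  by (auto simp: high_inflow_def \<alpha>_nonneg low_vec_nonneg high_flux_nonneg)

lemma solution_nonneg: "0 \<le> \<nu> \<Longrightarrow> 0 \<le> solution m \<nu> x"
  using \<delta>\<^sub>1_less \<delta>\<^sub>0_pos
  by (cases x) (auto simp: low_idle_pos less_imp_le low_vec_nonneg row_resolvent_nonneg
      high_inflow_nonneg high_flux_nonneg)

lemma low_vec_exit: "low_vec m \<nu> q \<bullet> exit_rate S = ((1 - \<delta>\<^sub>1) * lst \<nu>) ^ (m - q) * lst \<nu>"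
  by (simp add: low_vec_def row_lst)

lemma low_vec_one:
  assumes "0 \<le> \<nu>"
  shows "\<nu> * (low_vec m \<nu> q \<bullet> 1) = ((1 - \<delta>\<^sub>1) * lst \<nu>) ^ (m - q) * (1 - lst \<nu>)"
proof -
  have "\<nu> * ((\<alpha> v* resolvent \<nu>) \<bullet> 1) = 1 - lst \<nu>"
    using row_resolvent_one[OF assms, of \<alpha>] by (simp add: row_lst \<alpha>_one)
  then show ?thesis by (simp add: low_vec_def mult.left_commute)
qed

text \<open>The flow into \<open>Idle m\<close> is
  \<open>((1 - \<delta>\<^sub>1) * lst \<nu>) ^ m\<close>. Idle updates take the part computed in
  \<open>low_idle_update\<close>, and assignments take the rest.\<close>

lemma low_idle_assign:
  assumes "0 \<le> \<nu>"
  shows "\<nu> * low_idle m \<nu> = (1 - \<delta>\<^sub>1) ^ m * (lst \<nu> ^ m - idle_weight m \<nu>)"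
  using assms \<delta>\<^sub>0_pos
  unfolding low_idle_def idle_weight_def power_mult_distrib by (simp add: field_simps)

lemma low_idle_update: "\<delta>\<^sub>0 * low_idle m \<nu> = (1 - \<delta>\<^sub>1) ^ m * idle_weight m \<nu>"
  by (simp add: low_idle_def idle_weight_def power_mult_distrib)

text \<open>No assignment leaves the block with estimate \<open>m + 1\<close>, so a level completes
  all that flows into it; \<open>high_flux\<close> solves the resulting downward recursion.\<close>

lemma high_inflow_exit:
  assumes "0 \<le> \<nu>" "1 \<le> q" "q \<le> m + 1"
  shows "(high_inflow m \<nu> q v* resolvent 0) \<bullet> exit_rate S = high_flux m \<nu> q"
proof -
  have "(high_inflow m \<nu> q v* resolvent 0) \<bullet> exit_rate S = high_inflow m \<nu> q \<bullet> 1"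
    using row_resolvent_one[of 0] by simp
  \<comment> \<open>Assignments arrive from one level lower with estimate \<open>m\<close>, which
    for \<open>q = 1\<close> is the idle state; this is why \<open>idle_weight\<close> replaces a
    power of \<open>lst \<nu>\<close> there.\<close>
  also have "\<dots> = (if q = 1 then (1 - \<delta>\<^sub>1) ^ m * (lst \<nu> ^ m - idle_weight m \<nu>)
        else ((1 - \<delta>\<^sub>1) * lst \<nu>) ^ (m + 1 - q) * (1 - lst \<nu>))
      + (if q \<le> m then (1 - \<delta>\<^sub>1) * high_flux m \<nu> (q + 1) else 0)"
    using low_idle_assign[OF assms(1), of m] low_vec_one[OF assms(1), of m "q - 1"] assms(2)
    by (auto simp: high_inflow_def inner_add_left \<alpha>_one)
  also have "\<dots> = high_flux m \<nu> q"
  proof (cases "q = 1")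
    case True
    then show ?thesis
    proof (cases m)
      case (Suc k)
      then show ?thesis using True by (simp add: high_flux_def algebra_simps)
    qed (simp add: high_flux_def)
  next
    case False
    show ?thesis
    proof (cases "q = m + 1")
      case True
      then show ?thesis using False by (simp add: high_flux_def)
    next
      case ne: False
      then obtain k where k: "m = q + k" using assms(3) by (metis add.commute le_SucE le_iff_add Suc_eq_plus1)
      show ?thesis
        using False assms(2) unfolding k
        by (simp add: high_flux_def power_mult_distrib) (simp add: algebra_simps)
    qed
  qed
  finally show ?thesis .
qed

lemma phase_vec_solution:
  "phase_vec (solution m \<nu>) q m = low_vec m \<nu> q"
  "phase_vec (solution m \<nu>) q (Suc m) = high_inflow m \<nu> q v* resolvent 0"
  by (simp_all add: phase_vec_def vec_eq_iff)

lemma balanced_solution: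
  assumes "0 \<le> \<nu>" shows "balanced m \<nu> 1 (solution m \<nu>)"
  unfolding balanced_def
proof (intro conjI ballI)
  fix q assume q: "q \<in> {1..m}"
  have "((1 - \<delta>\<^sub>1) * lst \<nu>) ^ (m - q) = (1 - \<delta>\<^sub>1) * (((1 - \<delta>\<^sub>1) * lst \<nu>) ^ (m - (q + 1)) * lst \<nu>)" if "q \<noteq> m"
  proof -
    have "m - q = Suc (m - (q + 1))" using q that by auto
    then show ?thesis by simp
  qed
  then have "low_vec m \<nu> q = ((if q = m then 1 else (1 - \<delta>\<^sub>1) * flux (solution m \<nu>) (q + 1) m) *\<^sub>R \<alpha>) v* resolvent \<nu>"
    unfolding flux_def phase_vec_solution low_vec_exit
    by (simp add: low_vec_def scaleR_vector_matrix_mult)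
  then show "phase_vec (solution m \<nu>) q m v* (mat \<nu> - S)
      = (if q = m then 1 else (1 - \<delta>\<^sub>1) * flux (solution m \<nu>) (q + 1) m) *\<^sub>R \<alpha>"
    by (simp only: row_solve[OF assms] phase_vec_solution)
next
  show "(\<nu> + \<delta>\<^sub>0) * solution m \<nu> (Idle m) = (if m = 0 then 1 else (1 - \<delta>\<^sub>1) * flux (solution m \<nu>) 1 m)"
    unfolding flux_def phase_vec_solution low_vec_exit using assms \<delta>\<^sub>0_pos
    by (cases m) (auto simp: low_idle_def)
next
  fix q assume q: "q \<in> {1..m+1}"
  have "flux (solution m \<nu>) (q + 1) (m + 1) = high_flux m \<nu> (q + 1)" if "q \<le> m"
    using high_inflow_exit[OF assms, of "q + 1" m] that by (simp add: flux_def phase_vec_solution)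
  then have inflow: "high_inflow m \<nu> q
      = (if q = 1 then (\<nu> * low_idle m \<nu>) *\<^sub>R \<alpha> else \<nu> *\<^sub>R low_vec m \<nu> (q - 1))
        + (if q \<le> m then (1 - \<delta>\<^sub>1) * flux (solution m \<nu>) (q + 1) (m + 1) else 0) *\<^sub>R \<alpha>"
    by (cases "q \<le> m") (auto simp: high_inflow_def)
  show "phase_vec (solution m \<nu>) q (m + 1) v* (- S)
      = (if q = 1 then (\<nu> * solution m \<nu> (Idle m)) *\<^sub>R \<alpha> else \<nu> *\<^sub>R phase_vec (solution m \<nu>) (q - 1) m)
        + (if q \<le> m then (1 - \<delta>\<^sub>1) * flux (solution m \<nu>) (q + 1) (m + 1) else 0) *\<^sub>R \<alpha>"
    unfolding row_solve_0 phase_vec_solution inflow[symmetric] solution.simps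
    by (simp add: phase_vec_solution inflow)
next
  show "\<delta>\<^sub>0 * solution m \<nu> (Idle (m + 1)) = (1 - \<delta>\<^sub>1) * flux (solution m \<nu>) 1 (m + 1)"
    using high_inflow_exit[OF assms, of 1 m] \<delta>\<^sub>0_pos by (simp add: flux_def phase_vec_solution)
qed

section \<open>Uniqueness up to the update rate\<close>

lemma balanced_low:
  assumes "0 \<le> \<nu>" and bal: "balanced m \<nu> u g" and "1 \<le> q" "q \<le> m"
  shows "phase_vec g q m = u *\<^sub>R low_vec m \<nu> q"
  \<comment> \<open>The induction runs downwards: \<open>u\<close> alone feeds the top level, and
    level \<open>q\<close> is fed by the completions at \<open>q + 1\<close>.\<close>
  using assms(4) assms(3)
proof (induction q rule: inc_induct)
  case base
  then have "phase_vec g m m v* (mat \<nu> - S) = u *\<^sub>R \<alpha>"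
    using bal by (simp add: balanced_def)
  then show ?case
    by (simp add: row_solve[OF assms(1)] low_vec_def scaleR_vector_matrix_mult)
next
  case (step q)
  then have IH: "flux g (Suc q) m = u * (((1 - \<delta>\<^sub>1) * lst \<nu>) ^ (m - Suc q) * lst \<nu>)"
    by (simp add: flux_def low_vec_exit)
  have "phase_vec g q m v* (mat \<nu> - S) = ((1 - \<delta>\<^sub>1) * flux g (Suc q) m) *\<^sub>R \<alpha>"
    using bal step by (simp add: balanced_def)
  moreover have "m - q = Suc (m - Suc q)" using step by simp
  ultimately show ?case
    by (simp add: row_solve[OF assms(1)] IH low_vec_def scaleR_vector_matrix_mult mult_ac)
qed

lemma balanced_low_idle:
  assumes "0 \<le> \<nu>" and bal: "balanced m \<nu> u g"
  shows "g (Idle m) = u * low_idle m \<nu>"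
proof -
  have "(\<nu> + \<delta>\<^sub>0) * g (Idle m) = u * ((1 - \<delta>\<^sub>1) * lst \<nu>) ^ m"
  proof (cases m)
    case (Suc k)
    then show ?thesis
      using bal balanced_low[OF assms, of 1] by (simp add: balanced_def flux_def low_vec_exit mult_ac)
  qed (use bal in \<open>simp add: balanced_def\<close>)
  then show ?thesis using assms(1) \<delta>\<^sub>0_pos by (simp add: low_idle_def field_simps)
qed

text \<open>A second downward sweep; the assignments that feed this block are already determined by
  the first one.\<close>

lemma balanced_high:
  assumes "0 \<le> \<nu>" and bal: "balanced m \<nu> u g" and "1 \<le> q" "q \<le> m + 1"
  shows "phase_vec g q (m + 1) = u *\<^sub>R (high_inflow m \<nu> q v* resolvent 0)"
  using assms(4) assms(3)
proof (induction q rule: inc_induct)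
  case base
  have "phase_vec g (m + 1) (m + 1) v* (- S)
      = (if m = 0 then (\<nu> * g (Idle m)) *\<^sub>R \<alpha> else \<nu> *\<^sub>R phase_vec g m m)"
    using bal by (simp add: balanced_def)
  also have "\<dots> = u *\<^sub>R high_inflow m \<nu> (m + 1)"
    using balanced_low[OF assms(1,2), of m] balanced_low_idle[OF assms(1,2)]
    by (auto simp: high_inflow_def)
  finally show ?case by (simp only: row_solve_0 scaleR_vector_matrix_mult)
next
  case (step q)
  have flux: "flux g (q + 1) (m + 1) = u * high_flux m \<nu> (q + 1)"
    using step high_inflow_exit[OF assms(1), of "q + 1" m] by (simp add: flux_def)
  have "phase_vec g q (m + 1) v* (- S)
      = (if q = 1 then (\<nu> * g (Idle m)) *\<^sub>R \<alpha> else \<nu> *\<^sub>R phase_vec g (q - 1) m)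
          + ((1 - \<delta>\<^sub>1) * flux g (q + 1) (m + 1)) *\<^sub>R \<alpha>"
    using bal step unfolding balanced_def by simp
  also have "\<dots> = u *\<^sub>R high_inflow m \<nu> q"
    using balanced_low[OF assms(1,2), of "q - 1"] balanced_low_idle[OF assms(1,2)] step
    unfolding flux by (auto simp: high_inflow_def scaleR_add_right mult_ac)
  finally show ?case by (simp only: row_solve_0 scaleR_vector_matrix_mult)
qed

lemma balanced_unique:
  assumes "0 \<le> \<nu>" and bal: "balanced m \<nu> u g" and "x \<in> pull_states m"
  shows "g x = u * solution m \<nu> x"
proof -
  have low: "g (Busy q m j) = u * low_vec m \<nu> q $ j" if "1 \<le> q" "q \<le> m" for q j
    using balanced_low[OF assms(1,2) that] by (simp add: phase_vec_def vec_eq_iff)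
  have high: "g (Busy q (m + 1) j) = u * (high_inflow m \<nu> q v* resolvent 0) $ j"
    if "1 \<le> q" "q \<le> m + 1" for q j
    using balanced_high[OF assms(1,2) that] by (simp add: phase_vec_def vec_eq_iff)
  have "flux g 1 (m + 1) = u * high_flux m \<nu> 1"
    using balanced_high[OF assms(1,2), of 1] high_inflow_exit[OF assms(1), of 1 m] by (simp add: flux_def)
  then have idle: "g (Idle (m + 1)) = u * ((1 - \<delta>\<^sub>1) * high_flux m \<nu> 1 / \<delta>\<^sub>0)"
    using bal \<delta>\<^sub>0_pos by (simp add: balanced_def field_simps)
  show ?thesis
    using assms(3) low high idle balanced_low_idle[OF assms(1,2)]
    by (auto simp: pull_states_def)
qed

section \<open>Normalisation of the solution\<close>

definition idle_load :: "nat \<Rightarrow> real \<Rightarrow> real" where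
  "idle_load m \<nu> = (1 - \<delta>\<^sub>1) ^ m * ((1 - \<delta>\<^sub>1) + \<delta>\<^sub>1 * idle_weight m \<nu>)"

text \<open>Thus \<open>idle_load\<close> is the fraction of all updates that come from idle
  servers.\<close>

lemma idle_solution:
  "solution m \<nu> (Idle m) + solution m \<nu> (Idle (m + 1)) = idle_load m \<nu> / \<delta>\<^sub>0"
proof -
  have "low_idle m \<nu> = (1 - \<delta>\<^sub>1) ^ m * idle_weight m \<nu> / \<delta>\<^sub>0"
    using low_idle_update[of m \<nu>] \<delta>\<^sub>0_pos by (simp add: field_simps)
  then show ?thesis
    using \<delta>\<^sub>0_pos by (simp add: idle_load_def high_flux_def field_simps)
qed

lemma total_flux_solution:
  assumes "0 \<le> \<nu>"
  shows "(\<Sum>q=1..m. flux (solution m \<nu>) q m) + (\<Sum>q=1..m+1. flux (solution m \<nu>) q (m + 1))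
    = (1 - idle_load m \<nu>) / \<delta>\<^sub>1"
proof -
  have low: "flux (solution m \<nu>) q m = ((1 - \<delta>\<^sub>1) * lst \<nu>) ^ (m - q) * lst \<nu>" for q
    by (simp add: flux_def phase_vec_solution low_vec_exit)
  have high: "flux (solution m \<nu>) q (m + 1) = high_flux m \<nu> q" if "1 \<le> q" "q \<le> m + 1" for q
    using high_inflow_exit[OF assms that] by (simp add: flux_def phase_vec_solution)
  have "(\<Sum>q=1..m+1. flux (solution m \<nu>) q (m + 1)) = (\<Sum>q=1..Suc m. high_flux m \<nu> q)"
    using high by (intro sum.cong) auto
  also have "\<dots> = high_flux m \<nu> 1 + (\<Sum>q=1..m. high_flux m \<nu> (Suc q))"
    by (rule sum_split_first)
  finally have "(\<Sum>q=1..m. flux (solution m \<nu>) q m) + (\<Sum>q=1..m+1. flux (solution m \<nu>) q (m + 1))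
      = high_flux m \<nu> 1 + (\<Sum>q=1..m. ((1 - \<delta>\<^sub>1) * lst \<nu>) ^ (m - q) * lst \<nu> + high_flux m \<nu> (Suc q))"
    by (simp add: low sum.distrib)
  \<comment> \<open>Level crossing: pairing \<open>(q, m)\<close> with \<open>(q + 1, m + 1)\<close>
    makes the powers of \<open>lst \<nu>\<close> cancel.\<close>
  also have "(\<Sum>q=1..m. ((1 - \<delta>\<^sub>1) * lst \<nu>) ^ (m - q) * lst \<nu> + high_flux m \<nu> (Suc q)) = (\<Sum>q=1..m. (1 - \<delta>\<^sub>1) ^ (m - q))"
    by (intro sum.cong refl)
      (simp add: high_flux_def power_mult_distrib Suc_diff_le, simp add: algebra_simps)
  also have "\<dots> = (1 - (1 - \<delta>\<^sub>1) ^ m) / \<delta>\<^sub>1"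
    using sum_power_reverse[of "1 - \<delta>\<^sub>1" m] \<delta>\<^sub>1_pos by (simp add: field_simps)
  finally show ?thesis
    using \<delta>\<^sub>1_pos by (simp add: high_flux_def idle_load_def field_simps)
qed

text \<open>Closes the circle: the update rate that was prescribed as 1 is the true one, so
  \<open>solution\<close> satisfies global balance.\<close>

lemma update_rate_solution: "0 \<le> \<nu> \<Longrightarrow> update_rate m (solution m \<nu>) = 1"
  unfolding update_rate_def total_flux_solution idle_solution
  using \<delta>\<^sub>1_pos \<delta>\<^sub>0_pos by simp

text \<open>
  Summed over all levels, the assignments cancel: the total phase vector is a multiple of
  \<open>\<alpha> (-S)\<^sup>-\<^sup>1\<close>, whose completion rate and whose mass (the mean job size) are both \<open>1\<close>.
\<close>

lemma busy_mass_eq_flux: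
  assumes "0 \<le> \<nu>" and bal: "balanced m \<nu> u g"
  shows "(\<Sum>q=1..m. phase_vec g q m \<bullet> 1) + (\<Sum>q=1..m+1. phase_vec g q (m + 1) \<bullet> 1)
    = (\<Sum>q=1..m. flux g q m) + (\<Sum>q=1..m+1. flux g q (m + 1))"
proof -
  define X where "X = (\<Sum>q=1..m. phase_vec g q m) + (\<Sum>q=1..m+1. phase_vec g q (m + 1))"
  define c where "c q = (if q = m then u else (1 - \<delta>\<^sub>1) * flux g (q + 1) m)" for q
  define d where "d q = (if q \<le> m then (1 - \<delta>\<^sub>1) * flux g (q + 1) (m + 1) else 0)" for q
  define C where "C = (\<Sum>q=1..m. c q) + (\<nu> * g (Idle m) + (\<Sum>q=1..Suc m. d q))"
  have low: "phase_vec g q m v* (- S) = c q *\<^sub>R \<alpha> - \<nu> *\<^sub>R phase_vec g q m" if "q \<in> {1..m}" for q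
  proof -
    have "phase_vec g q m v* (mat \<nu> - S) = c q *\<^sub>R \<alpha>"
      using bal that unfolding balanced_def c_def by blast
    then show ?thesis
      by (simp add: vector_matrix_mult_diff_rdistrib vector_matrix_mult_mat_real)
        (simp add: vector_matrix_mult_def vec_eq_iff sum_negf algebra_simps)
  qed
  have high: "phase_vec g q (m + 1) v* (- S)
      = (if q = 1 then (\<nu> * g (Idle m)) *\<^sub>R \<alpha> else \<nu> *\<^sub>R phase_vec g (q - 1) m) + d q *\<^sub>R \<alpha>"
    if "q \<in> {1..Suc m}" for q
    using bal that unfolding balanced_def d_def by simp
  \<comment> \<open>After this index shift, the assignments into the upper block cancel the terms
    subtracted in \<open>low\<close>.\<close>
  have "(\<Sum>q=1..Suc m. if q = 1 then (\<nu> * g (Idle m)) *\<^sub>R \<alpha> else \<nu> *\<^sub>R phase_vec g (q - 1) m)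
      = (\<nu> * g (Idle m)) *\<^sub>R \<alpha> + (\<Sum>q=1..m. \<nu> *\<^sub>R phase_vec g q m)"
    by (simp only: sum_split_first) (auto intro!: sum.cong)
  then have "X v* (- S) = C *\<^sub>R \<alpha>"
    unfolding X_def C_def Suc_eq_plus1[symmetric] vector_matrix_left_distrib sum_vector_matrix_mult
    by (simp add: low high[unfolded Suc_eq_plus1[symmetric]] sum.distrib sum_subtractf scaleR_add_left scaleR_sum_left
        del: sum.cl_ivl_Suc)
  then have X: "X = C *\<^sub>R (\<alpha> v* resolvent 0)"
    by (simp add: row_solve_0 scaleR_vector_matrix_mult)
  have "X \<bullet> 1 = X \<bullet> exit_rate S"
    using row_mean row_lst[of 0] by (simp add: X lst_0)
  then show ?thesis
    by (simp add: X_def flux_def inner_add_left inner_sum_left del: sum.cl_ivl_Suc)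
qed

lemma sum_solution:
  assumes "0 \<le> \<nu>"
  shows "(\<Sum>x\<in>pull_states m. solution m \<nu> x) = idle_load m \<nu> / \<delta>\<^sub>0 + (1 - idle_load m \<nu>) / \<delta>\<^sub>1"
proof -
  have "(\<Sum>j\<in>UNIV. g (Busy q e j)) = phase_vec g q e \<bullet> 1" for g :: "'n state \<Rightarrow> real" and q e
    by (simp add: phase_vec_def inner_vec_def)
  then show ?thesis
    unfolding sum_pull_states \<open>\<And>g q e. (\<Sum>j\<in>UNIV. g (Busy q e j)) = phase_vec g q e \<bullet> 1\<close>
    using idle_solution[of m \<nu>] total_flux_solution[OF assms, of m]
      busy_mass_eq_flux[OF assms balanced_solution[OF assms], of m] by linarith
qed

text \<open>The second factor of \<open>idle_load\<close> is a convex combination of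
  \<open>1 - \<delta>\<^sub>1\<close> and 1 with a positive weight on 1.\<close>

lemma idle_load_bounds:
  assumes "0 \<le> \<nu>"
  shows "(1 - \<delta>\<^sub>1) ^ (m + 1) < idle_load m \<nu>" "idle_load m \<nu> \<le> (1 - \<delta>\<^sub>1) ^ m"
proof -
  show "(1 - \<delta>\<^sub>1) ^ (m + 1) < idle_load m \<nu>"
    using idle_weight_bounds[OF assms, of m] \<delta>\<^sub>1_pos \<delta>\<^sub>1_less
    by (simp add: idle_load_def algebra_simps)
  have "(1 - \<delta>\<^sub>1) + \<delta>\<^sub>1 * idle_weight m \<nu> \<le> 1"
    using idle_weight_bounds[OF assms, of m] \<delta>\<^sub>1_pos
    by (simp add: mult_left_le)
  then show "idle_load m \<nu> \<le> (1 - \<delta>\<^sub>1) ^ m"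
    using \<delta>\<^sub>1_less by (simp add: idle_load_def mult_left_le)
qed

lemma idle_load_pos: "0 \<le> \<nu> \<Longrightarrow> 0 < idle_load m \<nu>"
  and idle_load_le_1: "0 \<le> \<nu> \<Longrightarrow> idle_load m \<nu> \<le> 1"
  using idle_load_bounds[of \<nu> m] \<delta>\<^sub>1_less \<delta>\<^sub>1_pos zero_less_power[of "1 - \<delta>\<^sub>1" "m + 1"]
    power_le_one[of "1 - \<delta>\<^sub>1" m] by linarith+

subsection \<open>The stationary distribution and the queue at the cavity\<close>

text \<open>Justifies the \<open>THE\<close> in \<open>pull_stationary\<close>: a stationary
  distribution is balanced for its own update rate, hence a multiple of \<open>solution\<close>, and
  total mass 1 fixes the multiple.\<close>

lemma stationary_solution:
  fixes m :: nat
  assumes "0 \<le> \<nu>"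
  defines "Z \<equiv> idle_load m \<nu> / \<delta>\<^sub>0 + (1 - idle_load m \<nu>) / \<delta>\<^sub>1"
  shows "0 < Z"
    and "set_pmf (pull_stationary \<alpha> S \<delta>\<^sub>1 \<delta>\<^sub>0 m \<nu>) \<subseteq> pull_states m"
    and "x \<in> pull_states m \<Longrightarrow> pmf (pull_stationary \<alpha> S \<delta>\<^sub>1 \<delta>\<^sub>0 m \<nu>) x = solution m \<nu> x / Z"
proof -
  show Z: "0 < Z"
    unfolding Z_def using idle_load_pos[OF assms(1), of m] idle_load_le_1[OF assms(1), of m] \<delta>\<^sub>0_pos \<delta>\<^sub>1_pos
    by (intro add_pos_nonneg) auto
  let ?st = "stationary (pull_states m) (rate m \<nu>)"
  have unique: "pmf p x = solution m \<nu> x / Z" if st: "?st p" and x: "x \<in> pull_states m" for p x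
  proof -
    have bal: "balanced m \<nu> (update_rate m (pmf p)) (pmf p)"
      using st balance_iff[of m "pmf p" \<nu>] unfolding stationary_def by blast
    have eq: "pmf p y = update_rate m (pmf p) * solution m \<nu> y" if "y \<in> pull_states m" for y
      by (rule balanced_unique[OF assms(1) bal that])
    have "1 = (\<Sum>y\<in>pull_states m. pmf p y)"
      using st by (intro sum_pmf_eq_1[symmetric] finite_pull_states) (simp add: stationary_def)
    also have "\<dots> = update_rate m (pmf p) * Z"
      using eq by (simp add: sum_distrib_left[symmetric] sum_solution[OF assms(1)] Z_def)
    finally have "update_rate m (pmf p) = 1 / Z" using Z by (simp add: field_simps)
    then show ?thesis using eq[OF x] by simp
  qed
  define f where "f x = (if x \<in> pull_states m then solution m \<nu> x / Z else 0)" for x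
  have f_nonneg: "0 \<le> f x" for x
    using Z solution_nonneg[OF assms(1)] by (simp add: f_def)
  have "(\<integral>\<^sup>+x. ennreal (f x) \<partial>count_space UNIV) = (\<Sum>x\<in>pull_states m. ennreal (f x))"
    by (intro nn_integral_count_space' finite_pull_states) (auto simp: f_def)
  also have "\<dots> = ennreal (\<Sum>x\<in>pull_states m. f x)"
    using f_nonneg by (intro sum_ennreal) auto
  also have "(\<Sum>x\<in>pull_states m. f x) = 1"
    using Z by (simp add: f_def sum_divide_distrib[symmetric] sum_solution[OF assms(1)] Z_def)
  finally have "pmf (embed_pmf f) x = f x" for x
    using f_nonneg by (intro pmf_embed_pmf) auto
  then have pmf_f: "pmf (embed_pmf f) = f" by blast
  have "?st (embed_pmf f)"
    unfolding stationary_def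
  proof
    show "set_pmf (embed_pmf f) \<subseteq> pull_states m"
      by (auto simp: set_pmf_eq pmf_f f_def)
    have "\<forall>y\<in>pull_states m. (\<Sum>x\<in>pull_states m. solution m \<nu> x * rate m \<nu> x y)
        = solution m \<nu> y * (\<Sum>z\<in>pull_states m. rate m \<nu> y z)"
      unfolding balance_iff update_rate_solution[OF assms(1)] by (rule balanced_solution[OF assms(1)])
    then show "\<forall>y\<in>pull_states m. (\<Sum>x\<in>pull_states m. pmf (embed_pmf f) x * rate m \<nu> x y)
        = pmf (embed_pmf f) y * (\<Sum>z\<in>pull_states m. rate m \<nu> y z)"
      by (simp add: pmf_f f_def sum_divide_distrib[symmetric])
  qed
  moreover have "p = embed_pmf f" if "?st p" for p
  proof (rule pmf_eqI)
    fix x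
    show "pmf p x = pmf (embed_pmf f) x"
      using unique[OF that, of x] that by (auto simp: pmf_f f_def stationary_def pmf_eq_0_set_pmf)
  qed
  ultimately have st: "?st (pull_stationary \<alpha> S \<delta>\<^sub>1 \<delta>\<^sub>0 m \<nu>)"
    unfolding pull_stationary_def by (rule theI)
  then show "set_pmf (pull_stationary \<alpha> S \<delta>\<^sub>1 \<delta>\<^sub>0 m \<nu>) \<subseteq> pull_states m"
    by (simp add: stationary_def)
  show "x \<in> pull_states m \<Longrightarrow> pmf (pull_stationary \<alpha> S \<delta>\<^sub>1 \<delta>\<^sub>0 m \<nu>) x = solution m \<nu> x / Z"
    by (rule unique[OF st])
qed

lemma queue_prob_0:
  assumes "0 \<le> \<nu>"
  shows "queue_prob \<alpha> S \<delta>\<^sub>1 \<delta>\<^sub>0 m \<nu> 0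
    = \<delta>\<^sub>1 * idle_load m \<nu> / (\<delta>\<^sub>0 * (1 - idle_load m \<nu>) + \<delta>\<^sub>1 * idle_load m \<nu>)"
proof -
  let ?p = "pull_stationary \<alpha> S \<delta>\<^sub>1 \<delta>\<^sub>0 m \<nu>"
  let ?Z = "idle_load m \<nu> / \<delta>\<^sub>0 + (1 - idle_load m \<nu>) / \<delta>\<^sub>1"
  note sol = stationary_solution[OF assms, where m = m]
  \<comment> \<open>The event contains \<open>Idle e\<close> for every \<open>e\<close> and also
    \<open>Busy 0 e j\<close>; the support leaves at most two of these states.\<close>
  have "{x. queue_length x = 0} \<inter> set_pmf ?p = {Idle m, Idle (m + 1)} \<inter> set_pmf ?p"
    using sol(2) by (auto simp: pull_states_def)
  then have "queue_prob \<alpha> S \<delta>\<^sub>1 \<delta>\<^sub>0 m \<nu> 0 = measure_pmf.prob ?p {Idle m, Idle (m + 1)}"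
    unfolding queue_prob_def by (metis measure_Int_set_pmf)
  also have "\<dots> = pmf ?p (Idle m) + pmf ?p (Idle (m + 1))"
    by (simp add: measure_measure_pmf_finite)
  also have "\<dots> = (solution m \<nu> (Idle m) + solution m \<nu> (Idle (m + 1))) / ?Z"
    by (subst (1 2) sol(3)) (simp_all only: add_divide_distrib, auto simp: pull_states_def)
  also have "\<dots> = (idle_load m \<nu> / \<delta>\<^sub>0) / ?Z" by (simp only: idle_solution)
  also have "\<dots> = \<delta>\<^sub>1 * idle_load m \<nu> / (\<delta>\<^sub>0 * (1 - idle_load m \<nu>) + \<delta>\<^sub>1 * idle_load m \<nu>)"
  proof -
    have "?Z = (\<delta>\<^sub>0 * (1 - idle_load m \<nu>) + \<delta>\<^sub>1 * idle_load m \<nu>) / (\<delta>\<^sub>0 * \<delta>\<^sub>1)"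
      using \<delta>\<^sub>0_pos \<delta>\<^sub>1_pos by (simp add: field_simps)
    then show ?thesis using \<delta>\<^sub>0_pos \<delta>\<^sub>1_pos by simp
  qed
  finally show ?thesis .
qed

lemma queue_prob_pos_imp:
  assumes "0 \<le> \<nu>" "0 < queue_prob \<alpha> S \<delta>\<^sub>1 \<delta>\<^sub>0 m \<nu> q"
  shows "\<exists>x\<in>pull_states m. queue_length x = q \<and> 0 < solution m \<nu> x"
proof -
  let ?p = "pull_stationary \<alpha> S \<delta>\<^sub>1 \<delta>\<^sub>0 m \<nu>"
  note sol = stationary_solution[OF assms(1), where m = m]
  have "{x. queue_length x = q} \<inter> set_pmf ?p \<noteq> {}"
    using assms(2) measure_Int_set_pmf[of ?p "{x. queue_length x = q}"]
    unfolding queue_prob_def by force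
  then obtain x where x: "queue_length x = q" "x \<in> set_pmf ?p" by auto
  then have "x \<in> pull_states m" using sol(2) by blast
  moreover have "0 < solution m \<nu> x"
    using sol(1) sol(3)[OF calculation] pmf_positive[OF x(2)] by (simp add: zero_less_divide_iff)
  ultimately show ?thesis using x by blast
qed

lemma queue_prob_posI:
  assumes "0 \<le> \<nu>" "x \<in> pull_states m" "queue_length x = q" "solution m \<nu> x \<noteq> 0"
  shows "0 < queue_prob \<alpha> S \<delta>\<^sub>1 \<delta>\<^sub>0 m \<nu> q"
proof -
  let ?p = "pull_stationary \<alpha> S \<delta>\<^sub>1 \<delta>\<^sub>0 m \<nu>"
  note sol = stationary_solution[OF assms(1), where m = m]
  have "0 < pmf ?p x"
    using sol(1) sol(3)[OF assms(2)] solution_nonneg[OF assms(1), of m x] assms(4) by simp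
  also have "pmf ?p x \<le> queue_prob \<alpha> S \<delta>\<^sub>1 \<delta>\<^sub>0 m \<nu> q"
    unfolding queue_prob_def measure_pmf_single[symmetric]
    using assms(3) by (intro measure_pmf.finite_measure_mono) auto
  finally show ?thesis .
qed

section \<open>The largest queue length of a chain\<close>

lemma row_resolvent_nonzero:
  assumes "0 \<le> \<nu>" "b \<noteq> 0" shows "b v* resolvent \<nu> \<noteq> 0"
  using row_solve[OF assms(1), of 0 b] assms(2) by auto

lemma low_vec_nonzero: "0 \<le> \<nu> \<Longrightarrow> low_vec m \<nu> q \<noteq> 0"
  using row_resolvent_nonzero[OF _ \<alpha>_nonzero] lst_pos[of \<nu>] \<delta>\<^sub>1_less by (simp add: low_vec_def)

text \<open>Level \<open>(m + 1, m + 1)\<close> is fed by assignments only, from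
  \<open>(m, m)\<close> or, if \<open>m = 0\<close>, from \<open>Idle 0\<close>. Its inflow is
  nonzero exactly when \<nu> is, and the resolvent preserves being nonzero.\<close>

lemma max_queue_length:
  assumes "0 \<le> \<nu>" "0 < m \<or> 0 < \<nu>"
  shows "(GREATEST q. queue_prob \<alpha> S \<delta>\<^sub>1 \<delta>\<^sub>0 m \<nu> q > 0) = (if \<nu> = 0 then m else m + 1)"
proof (cases "\<nu> = 0")
  case True
  obtain j where "low_vec m \<nu> m $ j \<noteq> 0"
    using low_vec_nonzero[OF assms(1), of m m] by (auto simp: vec_eq_iff)
  then have "0 < queue_prob \<alpha> S \<delta>\<^sub>1 \<delta>\<^sub>0 m \<nu> m"
    using assms True by (intro queue_prob_posI[of _ "Busy m m j"]) (auto simp: pull_states_def)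
  moreover have "q \<le> m" if pos: "0 < queue_prob \<alpha> S \<delta>\<^sub>1 \<delta>\<^sub>0 m \<nu> q" for q
  proof (rule ccontr)
    assume "\<not> q \<le> m"
    obtain x where x: "x \<in> pull_states m" "queue_length x = q" "0 < solution m \<nu> x"
      using queue_prob_pos_imp[OF assms(1) pos] by blast
    then obtain j where "x = Busy (m + 1) (m + 1) j"
      using \<open>\<not> q \<le> m\<close> by (auto simp: pull_states_def)
    moreover have "high_inflow m \<nu> (m + 1) = 0" using True by (auto simp: high_inflow_def)
    ultimately show False using x(3) by simp
  qed
  ultimately show ?thesis using True by (auto intro!: Greatest_equality)
next
  case False
  have "high_inflow m \<nu> (m + 1) \<noteq> 0"
    using False low_idle_pos[OF assms(1), of m] low_vec_nonzero[OF assms(1), of m m] \<alpha>_nonzero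
    by (auto simp: high_inflow_def)
  then obtain j where "(high_inflow m \<nu> (m + 1) v* resolvent 0) $ j \<noteq> 0"
    using row_resolvent_nonzero[of 0] by (auto simp: vec_eq_iff)
  then have "0 < queue_prob \<alpha> S \<delta>\<^sub>1 \<delta>\<^sub>0 m \<nu> (m + 1)"
    using assms by (intro queue_prob_posI[of _ "Busy (m + 1) (m + 1) j"]) (auto simp: pull_states_def)
  moreover have "q \<le> m + 1" if pos: "0 < queue_prob \<alpha> S \<delta>\<^sub>1 \<delta>\<^sub>0 m \<nu> q" for q
    using queue_prob_pos_imp[OF assms(1) pos] by (auto simp: pull_states_def)
  ultimately show ?thesis using False by (auto intro!: Greatest_equality)
qed

section \<open>Inverting the idle probability\<close>

lemma idle_weight_strict_antimono:
  assumes "0 \<le> \<nu>" "\<nu> < \<mu>" shows "idle_weight m \<mu> < idle_weight m \<nu>"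
proof -
  have "lst \<mu> ^ m \<le> lst \<nu> ^ m"
    using assms lst_pos[of \<mu>] lst_antimono[of \<nu> \<mu>] by (intro power_mono) auto
  moreover have "\<delta>\<^sub>0 / (\<mu> + \<delta>\<^sub>0) < \<delta>\<^sub>0 / (\<nu> + \<delta>\<^sub>0)"
    using assms \<delta>\<^sub>0_pos by (intro divide_strict_left_mono) auto
  ultimately have "lst \<mu> ^ m * (\<delta>\<^sub>0 / (\<mu> + \<delta>\<^sub>0)) < lst \<nu> ^ m * (\<delta>\<^sub>0 / (\<nu> + \<delta>\<^sub>0))"
    using assms \<delta>\<^sub>0_pos lst_pos[of \<mu>] by (intro mult_le_less_imp_less) auto
  then show ?thesis by (simp add: idle_weight_def)
qed

lemma idle_weight_0: "idle_weight m 0 = 1"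
  using \<delta>\<^sub>0_pos by (simp add: idle_weight_def lst_0)

lemma idle_weight_surj:
  assumes "0 < t" "t \<le> 1" shows "\<exists>\<nu>\<ge>0. idle_weight m \<nu> = t"
proof -
  \<comment> \<open>Chosen so that \<open>\<delta>\<^sub>0 / b = t\<close>, which bounds the weight
    at \<open>b\<close>; the intermediate value theorem then applies on
    \<open>{0..b}\<close>.\<close>
  define b where "b = \<delta>\<^sub>0 / t"
  have "0 < b" using assms \<delta>\<^sub>0_pos by (simp add: b_def)
  have "lst b ^ m * (\<delta>\<^sub>0 / (b + \<delta>\<^sub>0)) \<le> 1 * (\<delta>\<^sub>0 / b)"
    using \<open>0 < b\<close> \<delta>\<^sub>0_pos lst_pos[of b] lst_le_1[of b]
    by (intro mult_mono power_le_one divide_left_mono) auto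
  then have "idle_weight m b \<le> t"
    using assms \<delta>\<^sub>0_pos by (simp add: idle_weight_def b_def)
  moreover have "continuous_on {0..b} (idle_weight m)"
    unfolding idle_weight_def using \<delta>\<^sub>0_pos
    by (intro continuous_intros continuous_on_subset[OF continuous_on_lst]) auto
  ultimately show ?thesis
    using IVT2'[of "idle_weight m" b t 0] assms \<open>0 < b\<close> by (auto simp: idle_weight_0)
qed

text \<open>Different \<open>m\<close> give disjoint ranges by \<open>idle_load_bounds\<close>; for
  equal \<open>m\<close> the weight is strictly decreasing in \<nu>.\<close>

lemma idle_load_inj:
  assumes "0 \<le> \<nu>" "0 \<le> \<mu>" and eq: "idle_load k \<nu> = idle_load m \<mu>"
  shows "k = m \<and> \<nu> = \<mu>"
proof -
  have less: "idle_load b y < idle_load a x" if "a < b" "0 \<le> x" "0 \<le> y" for a b x y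
  proof -
    have "idle_load b y \<le> (1 - \<delta>\<^sub>1) ^ b" by (rule idle_load_bounds[OF that(3)])
    also have "\<dots> \<le> (1 - \<delta>\<^sub>1) ^ (a + 1)"
      using that \<delta>\<^sub>1_pos \<delta>\<^sub>1_less by (intro power_decreasing) auto
    also have "\<dots> < idle_load a x" by (rule idle_load_bounds[OF that(2)])
    finally show ?thesis .
  qed
  have "k = m" using less[of k m \<nu> \<mu>] less[of m k \<mu> \<nu>] assms by (cases k m rule: linorder_cases) auto
  moreover have "idle_weight m \<nu> = idle_weight m \<mu>"
    using eq \<delta>\<^sub>1_pos \<delta>\<^sub>1_less by (simp add: idle_load_def \<open>k = m\<close>)
  then have "\<nu> = \<mu>"
    using idle_weight_strict_antimono[of \<nu> \<mu> m] idle_weight_strict_antimono[of \<mu> \<nu> m] assms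
    by (cases \<nu> \<mu> rule: linorder_cases) auto
  ultimately show ?thesis by simp
qed

lemma idle_load_surj:
  assumes "(1 - \<delta>\<^sub>1) ^ (m + 1) < M" "M \<le> (1 - \<delta>\<^sub>1) ^ m"
  shows "\<exists>\<nu>\<ge>0. idle_load m \<nu> = M"
proof -
  have p: "0 < (1 - \<delta>\<^sub>1) ^ m" using \<delta>\<^sub>1_less by simp
  \<comment> \<open>The weight that solves the affine equation
    \<open>idle_load m \<nu> = M\<close>.\<close>
  define t where "t = (M / (1 - \<delta>\<^sub>1) ^ m - (1 - \<delta>\<^sub>1)) / \<delta>\<^sub>1"
  have "0 < t" "t \<le> 1"
    using assms p \<delta>\<^sub>1_pos by (simp_all add: t_def pos_less_divide_eq pos_divide_le_eq mult.commute)
  then obtain \<nu> where "0 \<le> \<nu>" "idle_weight m \<nu> = t" using idle_weight_surj by blast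
  then have "idle_load m \<nu> = (1 - \<delta>\<^sub>1) ^ m * (M / (1 - \<delta>\<^sub>1) ^ m)"
    using \<delta>\<^sub>1_pos by (simp add: idle_load_def t_def)
  then show ?thesis using p \<open>0 \<le> \<nu>\<close> \<delta>\<^sub>1_less by (intro exI[of _ \<nu>]) simp
qed

lemma idle_prob_eq_iff:
  assumes "0 < M" "M \<le> 1" "0 \<le> arr" "arr < 1"
  shows "\<delta>\<^sub>1 * M / (\<delta>\<^sub>0 * (1 - M) + \<delta>\<^sub>1 * M) = 1 - arr
    \<longleftrightarrow> M = \<delta>\<^sub>0 * (1 - arr) / (\<delta>\<^sub>0 * (1 - arr) + \<delta>\<^sub>1 * arr)"
proof -
  have "0 < \<delta>\<^sub>0 * (1 - M) + \<delta>\<^sub>1 * M" "0 < \<delta>\<^sub>0 * (1 - arr) + \<delta>\<^sub>1 * arr"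
    using assms \<delta>\<^sub>0_pos \<delta>\<^sub>1_pos by (auto intro: add_nonneg_pos add_pos_nonneg)
  then show ?thesis
    by (simp add: divide_eq_eq eq_divide_eq) (auto simp: algebra_simps)
qed

text \<open>Justifies the \<open>THE\<close> in \<open>cavity_params\<close>: the idle probability
  determines the idle load, and this determines the pair.\<close>

lemma cavity_params_eq:
  assumes "0 \<le> arr" "arr < 1" "0 \<le> \<nu>"
    and load: "idle_load m \<nu> = \<delta>\<^sub>0 * (1 - arr) / (\<delta>\<^sub>0 * (1 - arr) + \<delta>\<^sub>1 * arr)"
  shows "cavity_params \<alpha> S \<delta>\<^sub>1 \<delta>\<^sub>0 arr = (m, \<nu>)"
proof -
  have "queue_prob \<alpha> S \<delta>\<^sub>1 \<delta>\<^sub>0 k \<mu> 0 = 1 - arr \<longleftrightarrow> k = m \<and> \<mu> = \<nu>" if "0 \<le> \<mu>" for k \<mu>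
    unfolding queue_prob_0[OF that]
      idle_prob_eq_iff[OF idle_load_pos[OF that] idle_load_le_1[OF that] assms(1,2)] load[symmetric]
    using idle_load_inj[OF that assms(3)] by blast
  then have "(\<lambda>(k, \<mu>). 0 \<le> \<mu> \<and> queue_prob \<alpha> S \<delta>\<^sub>1 \<delta>\<^sub>0 k \<mu> 0 = 1 - arr) = (\<lambda>x. x = (m, \<nu>))"
    using assms(3) by (auto simp: fun_eq_iff)
  then show ?thesis by (simp add: cavity_params_def)
qed

section \<open>Critical arrival rates\<close>

lemma critical_rate_denominator: "0 < \<delta>\<^sub>0 - \<delta>\<^sub>0 * (1 - \<delta>\<^sub>1) ^ m + \<delta>\<^sub>1 * (1 - \<delta>\<^sub>1) ^ m"
proof -
  have "\<delta>\<^sub>0 * (1 - \<delta>\<^sub>1) ^ m \<le> \<delta>\<^sub>0 * 1"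
    using \<delta>\<^sub>0_pos \<delta>\<^sub>1_pos \<delta>\<^sub>1_less by (intro mult_left_mono power_le_one) auto
  moreover have "0 < \<delta>\<^sub>1 * (1 - \<delta>\<^sub>1) ^ m" using \<delta>\<^sub>1_pos \<delta>\<^sub>1_less by simp
  ultimately show ?thesis by linarith
qed

lemma critical_rate_bounds: "0 \<le> critical_rate \<delta>\<^sub>1 \<delta>\<^sub>0 m" "critical_rate \<delta>\<^sub>1 \<delta>\<^sub>0 m < 1"
proof -
  have "\<delta>\<^sub>0 * (1 - \<delta>\<^sub>1) ^ m \<le> \<delta>\<^sub>0 * 1"
    using \<delta>\<^sub>0_pos \<delta>\<^sub>1_pos \<delta>\<^sub>1_less by (intro mult_left_mono power_le_one) auto
  then show "0 \<le> critical_rate \<delta>\<^sub>1 \<delta>\<^sub>0 m"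
    using critical_rate_denominator[of m] by (simp add: critical_rate_def)
  show "critical_rate \<delta>\<^sub>1 \<delta>\<^sub>0 m < 1"
    using critical_rate_denominator[of m] \<delta>\<^sub>1_pos \<delta>\<^sub>1_less by (simp add: critical_rate_def)
qed

text \<open>The critical rate is the arrival rate whose idle load is
  \<open>(1 - \<delta>\<^sub>1) ^ m\<close>, and the idle load decreases in the arrival
  rate.\<close>

lemma critical_rate_less_iff:
  assumes "0 \<le> arr" "arr < 1"
  shows "critical_rate \<delta>\<^sub>1 \<delta>\<^sub>0 m < arr
    \<longleftrightarrow> \<delta>\<^sub>0 * (1 - arr) / (\<delta>\<^sub>0 * (1 - arr) + \<delta>\<^sub>1 * arr) < (1 - \<delta>\<^sub>1) ^ m"
proof -
  have "0 < \<delta>\<^sub>0 * (1 - arr) + \<delta>\<^sub>1 * arr"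
    using assms \<delta>\<^sub>0_pos \<delta>\<^sub>1_pos by (auto intro: add_pos_nonneg)
  then show ?thesis
    unfolding critical_rate_def pos_divide_less_eq[OF critical_rate_denominator]
    by (simp add: pos_divide_less_eq) (auto simp: algebra_simps)
qed

lemma cavity_max_queue_length_eq:
  assumes "0 < m" and lower: "critical_rate \<delta>\<^sub>1 \<delta>\<^sub>0 (m - 1) < arr" and upper: "arr \<le> critical_rate \<delta>\<^sub>1 \<delta>\<^sub>0 m"
  shows "cavity_max_queue_length \<alpha> S \<delta>\<^sub>1 \<delta>\<^sub>0 arr = m"
proof -
  define M where "M = \<delta>\<^sub>0 * (1 - arr) / (\<delta>\<^sub>0 * (1 - arr) + \<delta>\<^sub>1 * arr)"
  have arr: "0 \<le> arr" "arr < 1"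
    using critical_rate_bounds(1)[of "m - 1"] critical_rate_bounds(2)[of m] lower upper by linarith+
  have M: "M < (1 - \<delta>\<^sub>1) ^ (m - 1)" "(1 - \<delta>\<^sub>1) ^ m \<le> M"
    using lower upper critical_rate_less_iff[OF arr] unfolding M_def by (auto simp: not_less[symmetric])
  \<comment> \<open>Only the right endpoint \<lambda>_m belongs to chain \<open>m\<close>, with
    \<nu> = 0 and maximum \<open>m\<close>. Inside the interval the chain is \<open>m - 1\<close>
    with \<nu> > 0, and its maximum is one more than its index.\<close>
  show ?thesis
  proof (cases "M = (1 - \<delta>\<^sub>1) ^ m")
    case True
    then have "idle_load m 0 = M" by (simp add: idle_load_def idle_weight_0)
    then have "cavity_params \<alpha> S \<delta>\<^sub>1 \<delta>\<^sub>0 arr = (m, 0)"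
      using arr by (intro cavity_params_eq) (auto simp: M_def)
    then show ?thesis
      using assms(1) by (simp add: cavity_max_queue_length_def max_queue_length)
  next
    case False
    then obtain \<nu> where \<nu>: "0 \<le> \<nu>" "idle_load (m - 1) \<nu> = M"
      using idle_load_surj[of "m - 1" M] M assms(1) by auto
    have "\<nu> \<noteq> 0"
      using \<nu> M by (auto simp: idle_load_def idle_weight_0)
    have "cavity_params \<alpha> S \<delta>\<^sub>1 \<delta>\<^sub>0 arr = (m - 1, \<nu>)"
      using arr \<nu> by (intro cavity_params_eq) (auto simp: M_def)
    then show ?thesis
      using assms(1) \<nu>(1) \<open>\<nu> \<noteq> 0\<close> by (simp add: cavity_max_queue_length_def max_queue_length)
  qed
qed

end

theorem corollary6p3:
  fixes \<alpha> :: "real^'n" and S :: "real^'n^'n" and \<delta>\<^sub>1 \<delta>\<^sub>0 arr :: real and m :: nat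
  assumes "0 < \<delta>\<^sub>1" and "\<delta>\<^sub>1 < 1" and "0 < \<delta>\<^sub>0"
    and "phase_type \<alpha> S" and "phase_type_mean \<alpha> S = 1"
    and "0 < m"
    and "arr \<in> {critical_rate \<delta>\<^sub>1 \<delta>\<^sub>0 (m - 1) <.. critical_rate \<delta>\<^sub>1 \<delta>\<^sub>0 m}"
  shows "cavity_max_queue_length \<alpha> S \<delta>\<^sub>1 \<delta>\<^sub>0 arr = m"
proof -
  interpret pull_policy \<alpha> S \<delta>\<^sub>1 \<delta>\<^sub>0 using assms by unfold_locales
  show ?thesis using assms(6,7) by (intro cavity_max_queue_length_eq) auto
qed

end
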